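(* For the optimal policy $\boldsymbol{F}^*=\{{f^*}_{q,a,\iota}^s\}$ there exist $(A+1)\times(S+1)\times L$ thresholds $q_{\boldsymbol{F}^*}(s,a,\iota)$, where $0\le q_{\boldsymbol{F}^*}(0,a,\iota)\le\cdots\le q_{\boldsymbol{F}^*}(S,a,\iota)\le Q$ for each arrival rate $a$, $0\le a\le A$, and index of channel state $\iota$, $1\le\iota\le L$. With the thresholds $q_{\boldsymbol{F}^*}(s,a,\iota)$ given, the optimal policy satisfies $$\begin{cases} {f^*}_{q,a,\iota}^s=1, & q_{\boldsymbol{F}^*}(s-1,a,\iota)<q\le q_{\boldsymbol{F}^*}(s,a,\iota),\ a\ne a^*\text{ or }s\ne s^*\text{ or }\iota\ne\iota^*,\\ {f^*}_{q,a,\iota}^s=1, & q_{\boldsymbol{F}^*}(s-1,a,\iota)<q<q_{\boldsymbol{F}^*}(s,a,\iota),\ a=a^*\text{ and }s=s^*\text{ and }\iota=\iota^*,\\ {f^*}_{q,a,\iota}^s+{f^*}_{q,a,\iota}^{s-1}=1, & q=q_{\boldsymbol{F}^*}(s,a,\iota),\ a=a^*\text{ and }s=s^*\text{ and }\iota=\iota^*,\\ {f^*}_{q,a,\iota}^s=0, & \text{otherwise,} \end{cases}$$ where the specific $s^*$, $a^*$, and $\iota^*$ are given by $\boldsymbol{F}^*$, and $q_{\boldsymbol{F}^*}(-1,a,\iota)=-1$ for each $a$ and $\iota$.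
   Context: Setting (single queue, adaptive transmitter, $L$-state block fading channel). $A,S,Q,L$ are positive integers with $S\ge A$ and $Q\ge A$. Arrivals $a[n]\in\{0,\dots,A\}$ form a stationary and ergodic Markov chain with transition probabilities $\gamma_{a,a'}$; $\alpha=\sum_a a\phi_a$ is the mean number of arrivals per slot, where $\phi$ is the stationary distribution. Channel states $h[n]\in\{h_1,\dots,h_L\}\subset\mathbb{C}$, $0<|h_1|<\cdots<|h_L|<\infty$, are i.i.d. over slots with $\Pr\{h[n]=h_\iota\}=\eta_\iota$, $\sum_\iota\eta_\iota=1$. The queue length $q[n]\in\{0,\dots,Q\}$ evolves by $q[n+1]=q[n]-s[n]+a[n+1]$, where the transmission rate $s[n]\in\{0,\dots,S\}$ must lie in $\mathcal{S}(q)=\{s:\max\{q-Q+A,0\}\le s\le\min\{q,S\}\}$ with $q=q[n]$. $P_{h_\iota}(s)$ is the power consumed when transmitting $s$ packets in channel state $h_\iota$; for each $\iota$, $P_{h_\iota}(0)=0$ and $P_{h_\iota}$ is monotonically increasing and convex in $s$. A policy is a family $\boldsymbol{F}=\{f_{q,a,\iota}^s\}$ ($0\le q\le Q$, $0\le a\le A$, $1\le\iota\le L$, $0\le s\le S$) with $f_{q,a,\iota}^s\ge0$, $\sum_s f_{q,a,\iota}^s=1$, $f_{q,a,\iota}^s=0$ for $s\notin\mathcal{S}(q)$; $f_{q,a,\iota}^s$ is the probability of $s[n]=s$ given $q[n]=q,a[n]=a,h[n]=h_\iota$. Under $\boldsymbol{F}$, $(q[n],a[n],h[n])$ is a Markov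 chain in which, under rate $s$, the transition from $(q,a,h_\iota)$ to $(q-s+a',a',h_{\iota'})$ has probability $\gamma_{a,a'}\eta_{\iota'}$. $\boldsymbol{F}$ obtains $(P,D)$ if this chain has a stationary distribution $\pi$ with $P=\sum_{q,a,\iota,s}P_{h_\iota}(s)\pi(q,a,\iota)f_{q,a,\iota}^s$ and $D=\frac1\alpha\sum_{q,a,\iota}q\,\pi(q,a,\iota)$. $\mathcal{R}$ is the set of all pairs $(P,D)$ obtained by policies, and the optimal delay-power tradeoff curve is $$\mathcal{L}=\{(P^*,D^* )\in\mathcal{R}:\ \text{for all }(\bar P,\bar D)\in\mathcal{R},\ \text{either }P^*\le\bar P\text{ or }D^*\le\bar D\}.$$ The optimal policy $\boldsymbol{F}^*$ is the one for a given power-delay pair on $\mathcal{L}$, i.e. the policy obtaining that pair; the statement is made for each pair on $\mathcal{L}$.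
   Formalization: The third row is corrected to f^s + f^{s+1} = 1 (as printed, with s-1, it fails for A=S=1, Q=2 and two channel states), and "the optimal policy" is read as "some policy obtaining the given pair", since such policies are not unique and not all have threshold form. *)

theory Defs
  imports Complex_Main
begin

text \<open>Finite Markov chains on a state set \<open>X\<close>, given by transition probabilities \<open>K x y\<close>.\<close>

definition transition_probs :: "'a set \<Rightarrow> ('a \<Rightarrow> 'a \<Rightarrow> real) \<Rightarrow> bool" where
  "transition_probs X K \<longleftrightarrow>
     (\<forall>x\<in>X. (\<forall>y\<in>X. 0 \<le> K x y) \<and> (\<Sum>y\<in>X. K x y) = 1)"

primrec n_step :: "'a set \<Rightarrow> ('a \<Rightarrow> 'a \<Rightarrow> real) \<Rightarrow> nat \<Rightarrow> 'a \<Rightarrow> 'a \<Rightarrow> real" where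
  "n_step X K 0 x y = (if x = y then 1 else 0)"
| "n_step X K (Suc n) x y = (\<Sum>z\<in>X. K x z * n_step X K n z y)"

definition ergodic_chain :: "'a set \<Rightarrow> ('a \<Rightarrow> 'a \<Rightarrow> real) \<Rightarrow> bool" where
  "ergodic_chain X K \<longleftrightarrow>
     transition_probs X K \<and>
     (\<forall>x\<in>X. \<forall>y\<in>X. \<exists>n. 0 < n_step X K n x y) \<and>
     (\<forall>x\<in>X. Gcd {n. 0 < n \<and> 0 < n_step X K n x x} = 1)"

definition stationary_distribution ::
  "'a set \<Rightarrow> ('a \<Rightarrow> 'a \<Rightarrow> real) \<Rightarrow> ('a \<Rightarrow> real) \<Rightarrow> bool" where
  "stationary_distribution X K \<pi> \<longleftrightarrow>
     (\<forall>x\<in>X. 0 \<le> \<pi> x) \<and> (\<Sum>x\<in>X. \<pi> x) = 1 \<and>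
     (\<forall>y\<in>X. (\<Sum>x\<in>X. \<pi> x * K x y) = \<pi> y)"

definition mean_arrivals :: "nat \<Rightarrow> (nat \<Rightarrow> real) \<Rightarrow> real" where
  "mean_arrivals A \<phi> = (\<Sum>a\<le>A. real a * \<phi> a)"

definition convex_seq :: "nat \<Rightarrow> (nat \<Rightarrow> real) \<Rightarrow> bool" where
  "convex_seq S p \<longleftrightarrow> (\<forall>s. s + 2 \<le> S \<longrightarrow> p (s + 1) - p s \<le> p (s + 2) - p (s + 1))"

text \<open>A policy \<open>f\<close> gives in \<open>f q a i s\<close> the probability of rate \<open>s\<close> when the queue length is
  \<open>q\<close>, the number of arrivals is \<open>a\<close> and the channel index is \<open>i\<close>.  Channel indices range
  over \<open>{1..L}\<close>.\<close>

type_synonym policy = "nat \<Rightarrow> nat \<Rightarrow> nat \<Rightarrow> nat \<Rightarrow> real"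

definition feasible_rates :: "nat \<Rightarrow> nat \<Rightarrow> nat \<Rightarrow> nat \<Rightarrow> nat set" where
  "feasible_rates A S Q q =
     {s. max (int q - int Q + int A) 0 \<le> int s \<and> s \<le> min q S}"

text \<open>The last conjunct makes \<open>f q a i s = 0\<close> also for \<open>s > S\<close>.\<close>

definition is_policy :: "nat \<Rightarrow> nat \<Rightarrow> nat \<Rightarrow> nat \<Rightarrow> policy \<Rightarrow> bool" where
  "is_policy A S Q L f \<longleftrightarrow>
     (\<forall>q\<le>Q. \<forall>a\<le>A. \<forall>i\<in>{1..L}.
        (\<forall>s\<le>S. 0 \<le> f q a i s) \<and> (\<Sum>s\<le>S. f q a i s) = 1 \<and>
        (\<forall>s. s \<notin> feasible_rates A S Q q \<longrightarrow> f q a i s = 0))"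

definition states :: "nat \<Rightarrow> nat \<Rightarrow> nat \<Rightarrow> (nat \<times> nat \<times> nat) set" where
  "states A Q L = {..Q} \<times> {..A} \<times> {1..L}"

text \<open>The condition \<open>q' + s = q + a'\<close> expresses \<open>q' = q - s + a'\<close> without truncated
  subtraction.\<close>

definition system_step ::
  "nat \<Rightarrow> (nat \<Rightarrow> nat \<Rightarrow> real) \<Rightarrow> (nat \<Rightarrow> real) \<Rightarrow> policy \<Rightarrow>
   nat \<times> nat \<times> nat \<Rightarrow> nat \<times> nat \<times> nat \<Rightarrow> real" where
  "system_step S \<gamma> \<eta> f = (\<lambda>(q, a, i) (q', a', i').
     \<Sum>s\<le>S. if q' + s = q + a' then f q a i s * \<gamma> a a' * \<eta> i' else 0)"

definition obtains_pair ::
  "nat \<Rightarrow> nat \<Rightarrow> nat \<Rightarrow> nat \<Rightarrow> (nat \<Rightarrow> nat \<Rightarrow> real) \<Rightarrow> (nat \<Rightarrow> real) \<Rightarrow> (nat \<Rightarrow> real) \<Rightarrow>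
   (nat \<Rightarrow> complex) \<Rightarrow> (complex \<Rightarrow> nat \<Rightarrow> real) \<Rightarrow> policy \<Rightarrow> real \<times> real \<Rightarrow> bool" where
  "obtains_pair A S Q L \<gamma> \<phi> \<eta> h P f PD \<longleftrightarrow>
     (\<exists>\<pi>. stationary_distribution (states A Q L) (system_step S \<gamma> \<eta> f) \<pi> \<and>
          fst PD = (\<Sum>(q, a, i)\<in>states A Q L. \<Sum>s\<le>S. P (h i) s * \<pi> (q, a, i) * f q a i s) \<and>
          snd PD = (1 / mean_arrivals A \<phi>) *
                     (\<Sum>(q, a, i)\<in>states A Q L. real q * \<pi> (q, a, i)))"

definition achievable_pairs ::
  "nat \<Rightarrow> nat \<Rightarrow> nat \<Rightarrow> nat \<Rightarrow> (nat \<Rightarrow> nat \<Rightarrow> real) \<Rightarrow> (nat \<Rightarrow> real) \<Rightarrow> (nat \<Rightarrow> real) \<Rightarrow>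
   (nat \<Rightarrow> complex) \<Rightarrow> (complex \<Rightarrow> nat \<Rightarrow> real) \<Rightarrow> (real \<times> real) set" where
  "achievable_pairs A S Q L \<gamma> \<phi> \<eta> h P =
     {PD. \<exists>f. is_policy A S Q L f \<and> obtains_pair A S Q L \<gamma> \<phi> \<eta> h P f PD}"

definition tradeoff_curve ::
  "nat \<Rightarrow> nat \<Rightarrow> nat \<Rightarrow> nat \<Rightarrow> (nat \<Rightarrow> nat \<Rightarrow> real) \<Rightarrow> (nat \<Rightarrow> real) \<Rightarrow> (nat \<Rightarrow> real) \<Rightarrow>
   (nat \<Rightarrow> complex) \<Rightarrow> (complex \<Rightarrow> nat \<Rightarrow> real) \<Rightarrow> (real \<times> real) set" where
  "tradeoff_curve A S Q L \<gamma> \<phi> \<eta> h P =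
     {(Ps, Ds) \<in> achievable_pairs A S Q L \<gamma> \<phi> \<eta> h P.
        \<forall>(Pb, Db) \<in> achievable_pairs A S Q L \<gamma> \<phi> \<eta> h P. Ps \<le> Pb \<or> Ds \<le> Db}"

text \<open>Thresholds \<open>thr s a i\<close> are integers indexed by \<open>s \<in> {-1..S}\<close>.\<close>

definition valid_thresholds ::
  "nat \<Rightarrow> nat \<Rightarrow> nat \<Rightarrow> nat \<Rightarrow> (int \<Rightarrow> nat \<Rightarrow> nat \<Rightarrow> int) \<Rightarrow> bool" where
  "valid_thresholds A S Q L thr \<longleftrightarrow>
     (\<forall>a\<le>A. \<forall>i\<in>{1..L}.
        thr (-1) a i = -1 \<and> 0 \<le> thr 0 a i \<and>
        (\<forall>s<S. thr (int s) a i \<le> thr (int s + 1) a i) \<and>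
        thr (int S) a i \<le> int Q)"

text \<open>At the randomised cell \<open>q = thr s\<^sub>0 a\<^sub>0 i\<^sub>0\<close>, \<open>a = a\<^sub>0\<close>, \<open>i = i\<^sub>0\<close> the policy mixes the
  neighbouring rates \<open>s\<^sub>0\<close> (used for \<open>q\<close> just below the threshold) and \<open>s\<^sub>0 + 1\<close> (whose
  interval starts just above it).  The clause for \<open>s\<^sub>0\<close> governs both entries, so
  \<open>f q a i (s\<^sub>0 + 1)\<close> is exempt from the final clause there.  If \<open>s\<^sub>0 = S\<close>, then
  \<open>f q a i (S + 1) = 0\<close> by \<open>is_policy\<close> and there is no randomisation.\<close>

definition threshold_form ::
  "nat \<Rightarrow> nat \<Rightarrow> nat \<Rightarrow> nat \<Rightarrow> (int \<Rightarrow> nat \<Rightarrow> nat \<Rightarrow> int) \<Rightarrow> nat \<Rightarrow> nat \<Rightarrow> nat \<Rightarrow> policy \<Rightarrow> bool" where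
  "threshold_form A S Q L thr s\<^sub>0 a\<^sub>0 i\<^sub>0 f \<longleftrightarrow>
     (\<forall>q\<le>Q. \<forall>a\<le>A. \<forall>i\<in>{1..L}. \<forall>s\<le>S.
        let lo = thr (int s - 1) a i; hi = thr (int s) a i;
            star = (a = a\<^sub>0 \<and> s = s\<^sub>0 \<and> i = i\<^sub>0);
            plain_one = (lo < int q \<and> int q \<le> hi \<and> \<not> star);
            star_one = (lo < int q \<and> int q < hi \<and> star);
            mixed = (int q = hi \<and> star);
            mixed_upper = (int q = thr (int s\<^sub>0) a\<^sub>0 i\<^sub>0 \<and> a = a\<^sub>0 \<and> s = s\<^sub>0 + 1 \<and> i = i\<^sub>0)
        in (plain_one \<longrightarrow> f q a i s = 1) \<and>
           (star_one \<longrightarrow> f q a i s = 1) \<and>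
           (mixed \<longrightarrow> f q a i s + f q a i (s + 1) = 1) \<and>
           (\<not> plain_one \<and> \<not> star_one \<and> \<not> mixed \<and> \<not> mixed_upper \<longrightarrow> f q a i s = 0))"

end

theory Submission
  imports Defs "HOL-Analysis.Analysis"
begin

text \<open>The achievable pairs form a convex set, since policies with a stationary distribution correspond
  to the points \<open>\<pi>(q,a,i) f(q,a,i,s)\<close> of a polytope.  A pair on the tradeoff curve therefore
  minimises \<open>l\<^sub>1 P + l\<^sub>2 D\<close> for some weights \<open>l\<^sub>1, l\<^sub>2 \<ge> 0\<close>, not both zero, and so comes from an optimal
  policy of an average-cost Markov decision process.  Its optimality equation has a solution that is
  convex in \<open>q\<close>: it is the limit of discounted value functions, which are infimal convolutions.
  Hence the best rates in each state form an interval, and its two ends \<open>lo\<close>, \<open>hi\<close> as well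
  as \<open>q - lo\<close>, \<open>q - hi\<close> are monotone in \<open>q\<close>.  By comparison with the given policy, \<open>lo\<close> has at least and
  \<open>hi\<close> at most its mean queue length.  Walking from \<open>lo\<close> to \<open>hi\<close> through monotone deterministic
  policies that change in one state by one packet, two consecutive policies enclose the desired queue
  length, and mixing their stationary distributions randomises in a single state.  All these
  policies have the same weighted cost, so the power is right as well if \<open>l\<^sub>1 > 0\<close>.  If \<open>l\<^sub>1 = 0\<close>, the best
  rates are unique and the given policy is already deterministic on its support.\<close>

section \<open>Infimal convolution of convex sequences\<close>

text \<open>The chain driven by a policy can have several stationary distributions, so the mean
  queue length is not a function of the policy. Hence comparison only asserts that a suitable
  distribution exists, the walk carries one distribution along with each policy, and mixing acts on
  the products \<open>\<pi> f\<close>. Balance and power are linear in these products, whereas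
  mixing the policies themselves would not interpolate the means.

  The limit of vanishing discount needs relative values that stay bounded. They are divided by their
  span, and an unbounded span is refuted by a maximum principle for the equation without costs.

  Two kinds of monotonicity have different tasks. A monotone remainder
  \<open>q - \<sigma> q a i\<close> lets the chain preserve monotone functions and is asked only of
  the two extreme policies, which are compared with the given one. Monotone rates produce
  thresholds, and they are what the intermediate policies of the walk retain.

  A pair on the curve is only weakly Pareto optimal, which is why a weight may vanish. If it is the
  weight of the power, equal weighted costs say nothing about the power.\<close>

lemma convex_seq_exchange:
  assumes "convex_seq N f" and "s < t" and "t \<le> N"
  shows "f (s + 1) + f (t - 1) \<le> f s + f t"
proof -
  \<comment> \<open>Increments grow, so the one at s is at most the one k places later; k = t - s -
    1 gives the last increment before t.\<close>
  have "s + 1 + k \<le> N \<Longrightarrow> f (s + 1) - f s \<le> f (s + 1 + k) - f (s + k)" for k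
  proof (induction k)
    case (Suc k)
    have "f (s + k + 1) - f (s + k) \<le> f (s + k + 2) - f (s + k + 1)"
      using assms(1) Suc.prems unfolding convex_seq_def by auto
    with Suc show ?case by simp
  qed simp
  from this[of "t - s - 1"] assms show ?thesis by simp
qed

lemma tendsto_Min:
  fixes f :: "'a \<Rightarrow> 'b \<Rightarrow> real"
  assumes "finite I" "I \<noteq> {}" "\<And>i. i \<in> I \<Longrightarrow> (f i \<longlongrightarrow> l i) F"
  shows "((\<lambda>n. Min ((\<lambda>i. f i n) ` I)) \<longlongrightarrow> Min (l ` I)) F"
  using assms
proof (induction I rule: finite_ne_induct)
  case (insert i I)
  then show ?case by (auto intro!: tendsto_min)
qed simp

lemma mono_on_atMost_SucI:
  fixes f :: "nat \<Rightarrow> 'a::order"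
  assumes "\<And>n. n < N \<Longrightarrow> f n \<le> f (Suc n)"
  shows "mono_on {..N} f"
proof (rule mono_onI)
  fix r s assume "r \<in> {..N}" "s \<in> {..N}" "r \<le> s"
  from \<open>r \<le> s\<close> \<open>s \<in> {..N}\<close> show "f r \<le> f s"
  proof (induction s rule: dec_induct)
    case (step n)
    then have "f r \<le> f n" "n < N" by auto
    then show ?case using assms[of n] by auto
  qed simp
qed

locale buffer =
  fixes A S Q :: nat
  assumes A_le_S: "A \<le> S" and A_le_Q: "A \<le> Q"
begin

abbreviation rates :: "nat \<Rightarrow> nat set" where "rates \<equiv> feasible_rates A S Q"

lemma mem_rates: "s \<in> rates q \<longleftrightarrow> q + A \<le> s + Q \<and> s \<le> q \<and> s \<le> S"
  by (auto simp: feasible_rates_def)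

lemma finite_rates [simp]: "finite (rates q)"
  by (rule finite_subset[of _ "{..S}"]) (auto simp: mem_rates)

text \<open>Sending as much as possible always leaves room for A arrivals: by \<open>A_le_Q\<close>
  if the buffer is emptied, by \<open>A_le_S\<close> if the cap S binds.\<close>

lemma min_in_rates: "q \<le> Q \<Longrightarrow> min q S \<in> rates q"
  using A_le_S A_le_Q by (auto simp: mem_rates)

lemma rates_nonempty: "q \<le> Q \<Longrightarrow> rates q \<noteq> {}"
  using min_in_rates by blast

text \<open>Feasibility of s means s \<le> S and that the remainder q - s lies between 0 and Q - A.
  So this is the plain infimal convolution of a sequence on \<open>{..S}\<close> with one on
  \<open>{..Q - A}\<close>, and the buffer limits create no boundary cases.\<close>

definition infconv :: "(nat \<Rightarrow> real) \<Rightarrow> (nat \<Rightarrow> real) \<Rightarrow> nat \<Rightarrow> real" where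
  "infconv f G q = Min ((\<lambda>s. f s + G (q - s)) ` rates q)"

definition best :: "(nat \<Rightarrow> real) \<Rightarrow> (nat \<Rightarrow> real) \<Rightarrow> nat \<Rightarrow> nat set" where
  "best f G q = {s \<in> rates q. f s + G (q - s) = infconv f G q}"

lemma infconv_le: "s \<in> rates q \<Longrightarrow> infconv f G q \<le> f s + G (q - s)"
  unfolding infconv_def by (rule Min_le) auto

lemma best_nonempty: "q \<le> Q \<Longrightarrow> best f G q \<noteq> {}"
proof -
  assume "q \<le> Q"
  then have "infconv f G q \<in> (\<lambda>s. f s + G (q - s)) ` rates q"
    unfolding infconv_def by (intro Min_in) (auto simp: rates_nonempty)
  then show ?thesis by (auto simp: best_def)
qed

lemma best_subset: "best f G q \<subseteq> rates q"
  by (auto simp: best_def)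

lemma finite_best [simp]: "finite (best f G q)"
  using best_subset finite_rates by (rule finite_subset)

lemma infconv_mono2:
  assumes "q \<le> Q" "\<And>r. r \<le> Q - A \<Longrightarrow> G r \<le> H r"
  shows "infconv f G q \<le> infconv f H q"
proof -
  obtain s where s: "s \<in> best f H q" using best_nonempty[OF assms(1)] by blast
  then have r: "s \<in> rates q" by (simp add: best_def)
  have "q - s \<le> Q - A" using r A_le_Q by (auto simp: mem_rates)
  then have "infconv f G q \<le> f s + H (q - s)"
    using infconv_le[OF r, of f G] assms(2)[of "q - s"] by linarith
  then show ?thesis using s by (simp add: best_def)
qed

lemma infconv_scale:
  assumes "q \<le> Q" and "0 < k"
  shows "infconv (\<lambda>s. k * f s) (\<lambda>r. k * G r) q = k * infconv f G q"
proof (rule antisym)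
  obtain s where s: "s \<in> best f G q" using best_nonempty[OF assms(1)] by blast
  show "infconv (\<lambda>s. k * f s) (\<lambda>r. k * G r) q \<le> k * infconv f G q"
    using infconv_le[of s q "\<lambda>s. k * f s" "\<lambda>r. k * G r"] s
    by (auto simp: best_def distrib_left[symmetric])
  obtain t where t: "t \<in> best (\<lambda>s. k * f s) (\<lambda>r. k * G r) q"
    using best_nonempty[OF assms(1)] by blast
  then have "infconv f G q \<le> f t + G (q - t)" by (intro infconv_le) (simp add: best_def)
  then have "k * infconv f G q \<le> k * (f t + G (q - t))" using assms(2) by simp
  then show "k * infconv f G q \<le> infconv (\<lambda>s. k * f s) (\<lambda>r. k * G r) q"
    using t by (simp add: best_def distrib_left)
qed

lemma infconv_add:
  assumes "q \<le> Q"
  shows "infconv f (\<lambda>r. G r + c) q = infconv f G q + c"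
proof (rule antisym)
  obtain s where s: "s \<in> best f G q" using best_nonempty[OF assms(1)] by blast
  show "infconv f (\<lambda>r. G r + c) q \<le> infconv f G q + c"
    using infconv_le[of s q f "\<lambda>r. G r + c"] s by (auto simp: best_def)
  obtain t where t: "t \<in> best f (\<lambda>r. G r + c) q" using best_nonempty[OF assms(1)] by blast
  then show "infconv f G q + c \<le> infconv f (\<lambda>r. G r + c) q"
    using infconv_le[of t q f G] by (auto simp: best_def)
qed

lemma infconv_tendsto:
  assumes "q \<le> Q" "\<And>s. s \<le> S \<Longrightarrow> (\<lambda>n. f n s) \<longlonglongrightarrow> f' s"
    "\<And>r. r \<le> Q - A \<Longrightarrow> (\<lambda>n. G n r) \<longlonglongrightarrow> G' r"
  shows "(\<lambda>n. infconv (f n) (G n) q) \<longlonglongrightarrow> infconv f' G' q"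
  unfolding infconv_def
  using A_le_Q
  by (intro tendsto_Min tendsto_add assms) (auto simp: rates_nonempty[OF assms(1)] mem_rates)

text \<open>Minimisers s at q and t at q + 2 give two competitors at q + 1. If s < t, move the rates
  towards each other and keep both remainders; otherwise keep the rates and move the remainders
  towards each other. Convexity of f or of G pays for the move.\<close>

lemma infconv_convex:
  assumes f: "convex_seq S f" and G: "convex_seq (Q - A) G"
  shows "convex_seq Q (infconv f G)"
  unfolding convex_seq_def
proof (intro allI impI)
  fix q assume q: "q + 2 \<le> Q"
  obtain s t where s: "s \<in> best f G q" and t: "t \<in> best f G (q + 2)"
    using best_nonempty[of q] best_nonempty[of "q + 2"] q by (meson add_leD1 ex_in_conv)
  then have sr: "s \<in> rates q" "t \<in> rates (q + 2)" by (simp_all add: best_def)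
  have "2 * infconv f G (q + 1) \<le> (f s + G (q - s)) + (f t + G (q + 2 - t))"
  proof (cases "s < t")
    case True
    have "f (s + 1) + f (t - 1) \<le> f s + f t"
      using convex_seq_exchange[OF f True] sr by (simp add: mem_rates)
    moreover have "infconv f G (q + 1) \<le> f (s + 1) + G (q + 1 - (s + 1))"
      by (rule infconv_le) (use sr True in \<open>auto simp: mem_rates\<close>)
    moreover have "infconv f G (q + 1) \<le> f (t - 1) + G (q + 1 - (t - 1))"
      by (rule infconv_le) (use sr True in \<open>auto simp: mem_rates\<close>)
    moreover have "q + 1 - (t - 1) = q + 2 - t" using True by simp
    ultimately show ?thesis by simp
  next
    case False
    have "G (q - s + 1) + G (q + 2 - t - 1) \<le> G (q - s) + G (q + 2 - t)"
      by (rule convex_seq_exchange[OF G]) (use sr False in \<open>auto simp: mem_rates\<close>)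
    moreover have "infconv f G (q + 1) \<le> f s + G (q + 1 - s)"
      by (rule infconv_le) (use sr False in \<open>auto simp: mem_rates\<close>)
    moreover have "infconv f G (q + 1) \<le> f t + G (q + 1 - t)"
      by (rule infconv_le) (use sr False in \<open>auto simp: mem_rates\<close>)
    moreover have "q + 1 - s = q - s + 1" "q + 2 - t - 1 = q + 1 - t"
      using sr by (auto simp: mem_rates)
    ultimately show ?thesis by simp
  qed
  also have "\<dots> = infconv f G q + infconv f G (q + 2)" using s t by (simp add: best_def)
  finally show "infconv f G (q + 1) - infconv f G q \<le> infconv f G (q + 2) - infconv f G (q + 1)"
    by simp
qed

lemma infconv_mono:
  assumes f: "mono_on {..S} f" and G: "mono_on {..Q - A} G"
  shows "mono_on {..Q} (infconv f G)"
proof (rule mono_on_atMost_SucI)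
  fix q assume q: "q < Q"
  then obtain t where t: "t \<in> best f G (Suc q)" using best_nonempty[of "Suc q"] by auto
  then have r: "t \<in> rates (Suc q)" by (simp add: best_def)
  \<comment> \<open>A minimiser of the longer queue is adapted to the shorter one: send one packet
    less and keep the remainder, or, if nothing is sent, let the remainder shrink.\<close>
  have "infconv f G q \<le> f t + G (Suc q - t)"
  proof (cases t)
    case 0
    have "infconv f G q \<le> f 0 + G (q - 0)"
      by (rule infconv_le) (use r 0 in \<open>auto simp: mem_rates\<close>)
    also have "G (q - 0) \<le> G (Suc q - 0)"
      by (rule mono_onD[OF G]) (use r 0 in \<open>auto simp: mem_rates\<close>)
    finally show ?thesis using 0 by simp
  next
    case (Suc t')
    have "infconv f G q \<le> f t' + G (q - t')"
      by (rule infconv_le) (use r Suc in \<open>auto simp: mem_rates\<close>)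
    also have "f t' \<le> f t"
      by (rule mono_onD[OF f]) (use r Suc in \<open>auto simp: mem_rates\<close>)
    finally show ?thesis using Suc by simp
  qed
  then show "infconv f G q \<le> infconv f G (Suc q)" using t by (simp add: best_def)
qed

section \<open>Exchange arguments for minimising rates\<close>

lemma best_exchange:
  assumes s: "s \<in> best f G q" and t: "t \<in> best f G q'" and s': "s' \<in> rates q'" and t': "t' \<in> rates q"
    and le: "f s' + G (q' - s') + (f t' + G (q - t')) \<le> f s + G (q - s) + (f t + G (q' - t))"
  shows "s' \<in> best f G q' \<and> t' \<in> best f G q"
  \<comment> \<open>The new values are each at least the respective minimum, and their sum is at
    most the sum of the minima; so both are minimal.\<close>
  using assms infconv_le[OF s', of f G] infconv_le[OF t', of f G] by (auto simp: best_def)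

text \<open>If a longer queue used a smaller rate, swapping the two rates moves the remainders
  towards each other, which costs nothing as G is convex.\<close>

lemma best_decreasing_exchange:
  assumes G: "convex_seq (Q - A) G"
    and s: "s \<in> best f G q" and t: "t \<in> best f G (Suc q)" and ts: "t < s"
  shows "s \<in> best f G (Suc q) \<and> t \<in> best f G q"
proof -
  have r: "s \<in> rates q" "t \<in> rates (Suc q)" using s t by (simp_all add: best_def)
  have "G (q - s + 1) + G (Suc q - t - 1) \<le> G (q - s) + G (Suc q - t)"
    by (rule convex_seq_exchange[OF G]) (use r ts in \<open>auto simp: mem_rates\<close>)
  moreover have "q - s + 1 = Suc q - s" "Suc q - t - 1 = q - t"
    using r by (auto simp: mem_rates)
  ultimately show ?thesis
    by (intro best_exchange[OF s t]) (use r ts in \<open>auto simp: mem_rates\<close>)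
qed

text \<open>If the rate jumps by more than one, moving the rates towards each other merely swaps the
  remainders, and convexity of f pays.\<close>

lemma best_jump_exchange:
  assumes f: "convex_seq S f"
    and s: "s \<in> best f G q" and t: "t \<in> best f G (Suc q)" and st: "Suc s < t"
  shows "Suc s \<in> best f G (Suc q) \<and> t - 1 \<in> best f G q"
proof -
  have r: "s \<in> rates q" "t \<in> rates (Suc q)" using s t by (simp_all add: best_def)
  have "f (s + 1) + f (t - 1) \<le> f s + f t"
    by (rule convex_seq_exchange[OF f]) (use r st in \<open>auto simp: mem_rates\<close>)
  moreover have "q - (t - 1) = Suc q - t" using st by simp
  ultimately show ?thesis
    by (intro best_exchange[OF s t]) (use r st in \<open>auto simp: mem_rates\<close>)
qed

text \<open>For a single queue length rates and remainders move inwards together, so the pair of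
  minimisers can be shrunk until one end meets m.\<close>

lemma best_interval:
  assumes f: "convex_seq S f" and G: "convex_seq (Q - A) G"
    and s: "s \<in> best f G q" and t: "t \<in> best f G q" and "s \<le> m" "m \<le> t"
  shows "m \<in> best f G q"
  using s t \<open>s \<le> m\<close> \<open>m \<le> t\<close>
proof (induction "t - s" arbitrary: s t rule: less_induct)
  case less
  have r: "s \<in> rates q" "t \<in> rates q" using less.prems by (simp_all add: best_def)
  show ?case
  proof (cases "s = m \<or> t = m")
    case False
    then have lt: "s < m" "m < t" using less.prems by auto
    have "f (s + 1) + f (t - 1) \<le> f s + f t"
      by (rule convex_seq_exchange[OF f]) (use r lt in \<open>auto simp: mem_rates\<close>)
    moreover have "G (q - t + 1) + G (q - s - 1) \<le> G (q - t) + G (q - s)"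
      by (rule convex_seq_exchange[OF G]) (use r lt in \<open>auto simp: mem_rates\<close>)
    moreover have "q - t + 1 = q - (t - 1)" "q - s - 1 = q - (s + 1)"
      using r lt by (auto simp: mem_rates)
    ultimately have "s + 1 \<in> best f G q \<and> t - 1 \<in> best f G q"
      by (intro best_exchange[OF less.prems(1,2)]) (use r lt in \<open>auto simp: mem_rates\<close>)
    then show ?thesis using lt by (intro less.hyps[of "t - 1" "s + 1"]) auto
  qed (use less.prems in auto)
qed

definition lowest :: "(nat \<Rightarrow> real) \<Rightarrow> (nat \<Rightarrow> real) \<Rightarrow> nat \<Rightarrow> nat" where
  "lowest f G q = Min (best f G q)"

definition highest :: "(nat \<Rightarrow> real) \<Rightarrow> (nat \<Rightarrow> real) \<Rightarrow> nat \<Rightarrow> nat" where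
  "highest f G q = Max (best f G q)"

lemma lowest_in: "q \<le> Q \<Longrightarrow> lowest f G q \<in> best f G q"
  unfolding lowest_def by (simp add: best_nonempty)

lemma highest_in: "q \<le> Q \<Longrightarrow> highest f G q \<in> best f G q"
  unfolding highest_def by (simp add: best_nonempty)

lemma lowest_le: "s \<in> best f G q \<Longrightarrow> lowest f G q \<le> s"
  unfolding lowest_def by simp

lemma le_highest: "s \<in> best f G q \<Longrightarrow> s \<le> highest f G q"
  unfolding highest_def by simp

text \<open>In each of the four cases a violation allows an exchange whose result is a minimiser
  beyond the extreme one.\<close>

lemma
  assumes f: "convex_seq S f" and G: "convex_seq (Q - A) G" and q: "q < Q"
  shows lowest_Suc: "lowest f G q \<le> lowest f G (Suc q)" "lowest f G (Suc q) \<le> Suc (lowest f G q)"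
    and highest_Suc: "highest f G q \<le> highest f G (Suc q)" "highest f G (Suc q) \<le> Suc (highest f G q)"
proof -
  note in1 = lowest_in[of q f G] lowest_in[of "Suc q" f G] highest_in[of q f G] highest_in[of "Suc q" f G]
  show "lowest f G q \<le> lowest f G (Suc q)"
    using best_decreasing_exchange[OF G, of "lowest f G q" f q "lowest f G (Suc q)"] in1 q
      lowest_le[of "lowest f G (Suc q)" f G q] by linarith
  show "lowest f G (Suc q) \<le> Suc (lowest f G q)"
    using best_jump_exchange[OF f, of "lowest f G q" G q "lowest f G (Suc q)"] in1 q
      lowest_le[of "Suc (lowest f G q)" f G "Suc q"] by linarith
  show "highest f G q \<le> highest f G (Suc q)"
    using best_decreasing_exchange[OF G, of "highest f G q" f q "highest f G (Suc q)"] in1 q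
      le_highest[of "highest f G q" f G "Suc q"] by linarith
  show "highest f G (Suc q) \<le> Suc (highest f G q)"
    using best_jump_exchange[OF f, of "highest f G q" G q "highest f G (Suc q)"] in1 q
      le_highest[of "highest f G (Suc q) - 1" f G q] by linarith
qed

end

section \<open>The discounted decision process\<close>

lemma bounded_subsequence_on_finite:
  fixes u :: "nat \<Rightarrow> 'a \<Rightarrow> real"
  assumes "finite I" and "\<And>n x. x \<in> I \<Longrightarrow> \<bar>u n x\<bar> \<le> B"
  shows "\<exists>r l. strict_mono (r :: nat \<Rightarrow> nat) \<and> (\<forall>x\<in>I. (\<lambda>n. u (r n) x) \<longlonglongrightarrow> l x)"
  using assms
proof (induction I rule: finite_induct)
  case empty
  show ?case by (intro exI[of _ id]) (simp add: strict_mono_def)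
next
  case (insert y I)
  then obtain r l where r: "strict_mono r" "\<forall>x\<in>I. (\<lambda>n. u (r n) x) \<longlonglongrightarrow> l x" by auto
  have "bounded (range (\<lambda>n. u (r n) y))"
    using insert.prems by (auto simp: bounded_iff)
  then obtain l' r' where r': "strict_mono r'" "((\<lambda>n. u (r n) y) \<circ> r') \<longlonglongrightarrow> l'"
    using bounded_imp_convergent_subsequence by blast
  have "(\<lambda>n. u ((r \<circ> r') n) x) \<longlonglongrightarrow> (l(y := l')) x" if "x \<in> insert y I" for x
  proof (cases "x = y")
    case False
    then have "((\<lambda>n. u (r n) x) \<circ> r') \<longlonglongrightarrow> l x"
      using r(2) that r'(1) by (intro LIMSEQ_subseq_LIMSEQ) auto
    then show ?thesis using False by (simp add: o_def)
  qed (use r'(2) in \<open>simp add: o_def\<close>)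
  then show ?case using strict_mono_o[OF r(1) r'(1)] by blast
qed

text \<open>The running cost is w per queued packet plus the price p i s of the rate. Keeping both
  abstract allows two instances: the true power with w = 0, and the weighted cost that a pair on the
  curve minimises.\<close>

locale queue_mdp = buffer +
  fixes L :: nat and \<gamma> :: "nat \<Rightarrow> nat \<Rightarrow> real" and \<eta> :: "nat \<Rightarrow> real"
    and p :: "nat \<Rightarrow> nat \<Rightarrow> real" and w :: real
  assumes A_pos: "0 < A" and ergodic: "ergodic_chain {..A} \<gamma>"
    and \<eta>_nonneg: "i \<in> {1..L} \<Longrightarrow> 0 \<le> \<eta> i" and sum_\<eta>: "(\<Sum>i=1..L. \<eta> i) = 1"
    and p_0: "i \<in> {1..L} \<Longrightarrow> p i 0 = 0"
    and p_mono: "i \<in> {1..L} \<Longrightarrow> mono_on {..S} (p i)"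
    and p_convex: "i \<in> {1..L} \<Longrightarrow> convex_seq S (p i)"
    and w_nonneg: "0 \<le> w"
begin

abbreviation X :: "(nat \<times> nat \<times> nat) set" where "X \<equiv> states A Q L"

lemma mem_X: "(q, a, i) \<in> X \<longleftrightarrow> q \<le> Q \<and> a \<le> A \<and> i \<in> {1..L}"
  by (auto simp: states_def)

lemma finite_X [simp]: "finite X"
  by (simp add: states_def)

lemma L_pos: "0 < L"
  using sum_\<eta> by (cases "L = 0") auto

lemma X_nonempty: "X \<noteq> {}"
  using L_pos by (auto simp: states_def)

lemma \<gamma>_nonneg: "a \<le> A \<Longrightarrow> a' \<le> A \<Longrightarrow> 0 \<le> \<gamma> a a'"
  using ergodic by (auto simp: ergodic_chain_def transition_probs_def)

lemma sum_\<gamma>: "a \<le> A \<Longrightarrow> (\<Sum>a'\<le>A. \<gamma> a a') = 1"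
  using ergodic by (auto simp: ergodic_chain_def transition_probs_def)

lemma p_nonneg: "i \<in> {1..L} \<Longrightarrow> s \<le> S \<Longrightarrow> 0 \<le> p i s"
  using mono_onD[OF p_mono, of i 0 s] p_0 by auto

text \<open>Conditional expectation of \<open>u\<close> at the next slot, when \<open>r\<close> packets remain after the
  transmission.\<close>

definition next_val :: "(nat \<times> nat \<times> nat \<Rightarrow> real) \<Rightarrow> nat \<Rightarrow> nat \<Rightarrow> real" where
  "next_val u a r = (\<Sum>a'\<le>A. \<Sum>i'=1..L. \<gamma> a a' * \<eta> i' * u (r + a', a', i'))"

definition bellman :: "real \<Rightarrow> (nat \<times> nat \<times> nat \<Rightarrow> real) \<Rightarrow> nat \<times> nat \<times> nat \<Rightarrow> real" where
  "bellman \<beta> u = (\<lambda>(q, a, i). w * real q + infconv (p i) (\<lambda>r. \<beta> * next_val u a r) q)"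

definition monotone_val :: "(nat \<times> nat \<times> nat \<Rightarrow> real) \<Rightarrow> bool" where
  "monotone_val u \<longleftrightarrow> (\<forall>a\<le>A. \<forall>i\<in>{1..L}. mono_on {..Q} (\<lambda>q. u (q, a, i)))"

definition convex_val :: "(nat \<times> nat \<times> nat \<Rightarrow> real) \<Rightarrow> bool" where
  "convex_val u \<longleftrightarrow> (\<forall>a\<le>A. \<forall>i\<in>{1..L}. convex_seq Q (\<lambda>q. u (q, a, i)))"

lemma next_in_X:
  "r \<le> Q - A \<Longrightarrow> a' \<le> A \<Longrightarrow> i' \<in> {1..L} \<Longrightarrow> (r + a', a', i') \<in> X"
  using A_le_Q by (simp add: mem_X)

lemma next_val_le:
  assumes "\<And>x. x \<in> X \<Longrightarrow> u x \<le> v x" "a \<le> A" "r \<le> Q - A"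
  shows "next_val u a r \<le> next_val v a r"
  unfolding next_val_def
  by (intro sum_mono mult_left_mono mult_nonneg_nonneg assms next_in_X \<gamma>_nonneg \<eta>_nonneg)
    (use assms in auto)

lemma next_val_affine:
  assumes "a \<le> A"
  shows "next_val (\<lambda>x. k * u x + c) a r = k * next_val u a r + c"
proof -
  have "next_val (\<lambda>x. k * u x + c) a r =
      (\<Sum>a'\<le>A. \<Sum>i'=1..L. k * (\<gamma> a a' * \<eta> i' * u (r + a', a', i')) + c * (\<gamma> a a' * \<eta> i'))"
    unfolding next_val_def by (intro sum.cong) (auto simp: algebra_simps)
  also have "\<dots> = k * next_val u a r + c * (\<Sum>a'\<le>A. \<gamma> a a' * (\<Sum>i'=1..L. \<eta> i'))"
    by (simp add: sum.distrib next_val_def sum_distrib_left)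
  finally show ?thesis using sum_\<gamma>[OF assms] sum_\<eta> by simp
qed

lemma next_val_const: "a \<le> A \<Longrightarrow> next_val (\<lambda>_. c) a r = c"
  using next_val_affine[of a 0 "\<lambda>_. 0" c r] by simp

lemma next_val_mono:
  assumes "monotone_val u" "a \<le> A"
  shows "mono_on {..Q - A} (next_val u a)"
proof (rule mono_onI)
  fix r t assume rt: "r \<in> {..Q - A}" "t \<in> {..Q - A}" "r \<le> t"
  have "u (r + a', a', i') \<le> u (t + a', a', i')" if "a' \<le> A" "i' \<in> {1..L}" for a' i'
    using assms(1) that rt A_le_Q by (auto simp: monotone_val_def intro: mono_onD[of "{..Q}" "\<lambda>q. u (q, a', i')"])
  then show "next_val u a r \<le> next_val u a t"
    unfolding next_val_def
    by (intro sum_mono mult_left_mono mult_nonneg_nonneg \<gamma>_nonneg \<eta>_nonneg) (use assms in auto)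
qed

lemma next_val_convex:
  assumes "convex_val u" "a \<le> A"
  shows "convex_seq (Q - A) (next_val u a)"
  unfolding convex_seq_def
proof (intro allI impI)
  fix r assume r: "r + 2 \<le> Q - A"
  have "u (r + 1 + a', a', i') - u (r + a', a', i') \<le> u (r + 2 + a', a', i') - u (r + 1 + a', a', i')"
    if "a' \<le> A" "i' \<in> {1..L}" for a' i'
  proof -
    have "r + a' + 2 \<le> Q" using r that A_le_Q by simp
    moreover have "convex_seq Q (\<lambda>q. u (q, a', i'))"
      using assms(1) that by (simp add: convex_val_def)
    ultimately have "u (r + a' + 1, a', i') - u (r + a', a', i') \<le> u (r + a' + 2, a', i') - u (r + a' + 1, a', i')"
      unfolding convex_seq_def by blast
    then show ?thesis by (simp add: add_ac)
  qed
  then show "next_val u a (r + 1) - next_val u a r \<le> next_val u a (r + 2) - next_val u a (r + 1)"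
    unfolding next_val_def sum_subtractf[symmetric] right_diff_distrib[symmetric]
    by (intro sum_mono mult_left_mono mult_nonneg_nonneg \<gamma>_nonneg \<eta>_nonneg) (use assms in auto)
qed

lemma next_val_tendsto:
  assumes "\<And>x. x \<in> X \<Longrightarrow> (\<lambda>n. u n x) \<longlonglongrightarrow> l x" "r \<le> Q - A"
  shows "(\<lambda>n. next_val (u n) a r) \<longlonglongrightarrow> next_val l a r"
  unfolding next_val_def
  by (intro tendsto_sum tendsto_mult tendsto_const assms next_in_X) (use assms in auto)

lemma bellman_le:
  assumes "\<And>x. x \<in> X \<Longrightarrow> u x \<le> v x" "0 \<le> \<beta>" "x \<in> X"
  shows "bellman \<beta> u x \<le> bellman \<beta> v x"
proof -
  obtain q a i where x: "x = (q, a, i)" by (cases x)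
  show ?thesis
    using assms(3) unfolding bellman_def x prod.case
    by (intro add_left_mono infconv_mono2 mult_left_mono next_val_le assms) (auto simp: mem_X)
qed

lemma infconv_next_monotone:
  assumes "monotone_val u" "0 \<le> \<beta>" "a \<le> A" "i \<in> {1..L}"
  shows "mono_on {..Q} (infconv (p i) (\<lambda>r. \<beta> * next_val u a r))"
proof (rule infconv_mono[OF p_mono[OF assms(4)]])
  show "mono_on {..Q - A} (\<lambda>r. \<beta> * next_val u a r)"
    using next_val_mono[OF assms(1,3)] assms(2)
    by (auto simp: monotone_on_def mult_left_mono)
qed

lemma bellman_monotone:
  assumes "monotone_val u" "0 \<le> \<beta>"
  shows "monotone_val (bellman \<beta> u)"
  using infconv_next_monotone[OF assms] w_nonneg
  by (auto simp: monotone_val_def bellman_def monotone_on_def intro!: add_mono mult_left_mono)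

lemma bellman_convex:
  assumes "convex_val u" "0 \<le> \<beta>"
  shows "convex_val (bellman \<beta> u)"
  unfolding convex_val_def
proof (intro allI ballI impI)
  fix a i assume ai: "a \<le> A" "i \<in> {1..L}"
  have "convex_seq (Q - A) (\<lambda>r. \<beta> * next_val u a r)"
    using next_val_convex[OF assms(1) ai(1)] assms(2)
    by (auto simp: convex_seq_def right_diff_distrib[symmetric] intro!: mult_left_mono)
  then have "convex_seq Q (infconv (p i) (\<lambda>r. \<beta> * next_val u a r))"
    by (rule infconv_convex[OF p_convex[OF ai(2)]])
  then show "convex_seq Q (\<lambda>q. bellman \<beta> u (q, a, i))"
    by (simp add: convex_seq_def bellman_def algebra_simps)
qed

lemma monotone_val_limit:
  assumes "\<And>n. monotone_val (u n)" "\<And>x. x \<in> X \<Longrightarrow> (\<lambda>n. u n x) \<longlonglongrightarrow> l x"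
  shows "monotone_val l"
  unfolding monotone_val_def
proof (intro allI ballI impI mono_onI)
  fix a i r t assume *: "a \<le> A" "i \<in> {1..L}" "r \<in> {..Q}" "t \<in> {..Q}" "r \<le> t"
  show "l (r, a, i) \<le> l (t, a, i)"
  proof (rule LIMSEQ_le[OF assms(2) assms(2)])
    show "\<exists>N. \<forall>n\<ge>N. u n (r, a, i) \<le> u n (t, a, i)"
      using assms(1) * unfolding monotone_val_def monotone_on_def by blast
  qed (use * in \<open>auto simp: mem_X\<close>)
qed

lemma convex_val_limit:
  assumes "\<And>n. convex_val (u n)" "\<And>x. x \<in> X \<Longrightarrow> (\<lambda>n. u n x) \<longlonglongrightarrow> l x"
  shows "convex_val l"
  unfolding convex_val_def convex_seq_def
proof (intro allI ballI impI)
  fix a i q assume *: "a \<le> A" "i \<in> {1..L}" "q + 2 \<le> Q"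
  have t: "(\<lambda>n. u n (q + k, a, i)) \<longlonglongrightarrow> l (q + k, a, i)" if "k \<le> 2" for k
    using that * by (intro assms) (auto simp: mem_X)
  show "l (q + 1, a, i) - l (q, a, i) \<le> l (q + 2, a, i) - l (q + 1, a, i)"
  proof (rule LIMSEQ_le[OF tendsto_diff tendsto_diff])
    show "\<exists>N. \<forall>n\<ge>N. u n (q + 1, a, i) - u n (q, a, i) \<le> u n (q + 2, a, i) - u n (q + 1, a, i)"
      using assms(1) * unfolding convex_val_def convex_seq_def by blast
  qed (use t[of 0] t[of 1] t[of 2] in auto)
qed

lemma cost_bound: "\<exists>C. \<forall>(q, a, i)\<in>X. \<forall>s\<le>S. w * real q + p i s \<le> C"
proof (intro exI ballI, clarify)
  fix q a i s assume x: "(q, a, i) \<in> X" "s \<le> S"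
  have "p i s \<le> p i S" using x by (auto simp: mem_X intro!: mono_onD[OF p_mono])
  also have "\<dots> \<le> (\<Sum>i=1..L. p i S)"
    using x p_nonneg by (intro member_le_sum) (auto simp: mem_X)
  finally show "w * real q + p i s \<le> w * real Q + (\<Sum>i=1..L. p i S)"
    using x w_nonneg by (intro add_mono mult_left_mono) (auto simp: mem_X)
qed

lemma infconv_p_nonneg:
  assumes "(q, a, i) \<in> X" "\<And>r. r \<le> Q - A \<Longrightarrow> 0 \<le> G r"
  shows "0 \<le> infconv (p i) G q"
proof -
  obtain s where s: "s \<in> best (p i) G q"
    using best_nonempty[of q "p i" G] assms(1) by (auto simp: mem_X)
  then have "s \<in> rates q" by (simp add: best_def)
  then have "q - s \<le> Q - A" "s \<le> S" using A_le_Q by (auto simp: mem_rates)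
  then show ?thesis
    using s assms(1) p_nonneg[of i s] assms(2)[of "q - s"] by (auto simp: best_def mem_X)
qed

text \<open>Value iteration from 0 is increasing and bounded, hence convergent. The Bellman operator
  is continuous for pointwise limits, so the limit is a fixed point; it inherits monotonicity and
  convexity from the iterates.\<close>

lemma discounted_value:
  assumes C: "\<forall>(q, a, i)\<in>X. \<forall>s\<le>S. w * real q + p i s \<le> C" and \<beta>: "0 \<le> \<beta>" "\<beta> < 1"
  obtains V where "\<And>x. x \<in> X \<Longrightarrow> V x = bellman \<beta> V x"
    "\<And>x. x \<in> X \<Longrightarrow> 0 \<le> V x" "\<And>x. x \<in> X \<Longrightarrow> V x \<le> C / (1 - \<beta>)"
    "monotone_val V" "convex_val V"
proof -
  define U where "U n = (bellman \<beta> ^^ n) (\<lambda>_. 0)" for n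
  have U_0: "U 0 = (\<lambda>_. 0)" and U_Suc: "U (Suc n) = bellman \<beta> (U n)" for n
    by (simp_all add: U_def)
  have nonneg: "0 \<le> bellman \<beta> u x" if "\<And>x. x \<in> X \<Longrightarrow> 0 \<le> u x" "x \<in> X" for u x
  proof -
    obtain q a i where x: "x = (q, a, i)" by (cases x)
    have "0 \<le> next_val u a r" if "r \<le> Q - A" for r
      using next_val_le[of "\<lambda>_. 0" u a r] \<open>x \<in> X\<close> x that \<open>\<And>x. x \<in> X \<Longrightarrow> 0 \<le> u x\<close>
      by (auto simp: next_val_const mem_X)
    then show ?thesis
      using \<open>x \<in> X\<close> \<beta> w_nonneg unfolding bellman_def x prod.case
      by (intro add_nonneg_nonneg infconv_p_nonneg[of q a i] mult_nonneg_nonneg) auto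
  qed
  have bound: "bellman \<beta> u x \<le> C + \<beta> * B" if u: "\<And>x. x \<in> X \<Longrightarrow> u x \<le> B" and "x \<in> X" for u x B
  proof -
    obtain q a i where x: "x = (q, a, i)" by (cases x)
    have s: "min q S \<in> rates q" using that x by (auto simp: mem_X intro!: min_in_rates)
    have "infconv (p i) (\<lambda>r. \<beta> * next_val u a r) q \<le> p i (min q S) + \<beta> * next_val u a (q - min q S)"
      by (rule infconv_le[OF s])
    moreover have "next_val u a (q - min q S) \<le> next_val (\<lambda>_. B) a (q - min q S)"
      using s u that x A_le_Q by (intro next_val_le) (auto simp: mem_rates mem_X)
    moreover have "next_val (\<lambda>_. B) a (q - min q S) = B"
      using that x by (simp add: next_val_const mem_X)
    ultimately have "infconv (p i) (\<lambda>r. \<beta> * next_val u a r) q \<le> p i (min q S) + \<beta> * B"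
      using \<beta> by (smt (verit) mult_left_mono)
    moreover have "w * real q + p i (min q S) \<le> C" using C that x by auto
    ultimately show ?thesis by (simp add: bellman_def x)
  qed
  \<comment> \<open>The fixed point of \<open>B = C + \<beta> * B\<close>, so that the bound
    reproduces itself in each iteration.\<close>
  define B where "B = C / (1 - \<beta>)"
  have B: "C + \<beta> * B = B" using \<beta> by (simp add: B_def field_simps)
  have "0 \<le> C"
    using C[rule_format, of "(0, 0, 1)"] L_pos p_0[of 1] by (auto simp: mem_X)
  then have "0 \<le> B" using \<beta> by (simp add: B_def)
  have U_bounds: "x \<in> X \<Longrightarrow> 0 \<le> U n x \<and> U n x \<le> B" for n x
  proof (induction n arbitrary: x)
    case (Suc n)
    then show ?case using nonneg[of "U n" x] bound[of "U n" B x] by (simp add: U_Suc B)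
  qed (simp add: U_0 \<open>0 \<le> B\<close>)
  have U_mono: "x \<in> X \<Longrightarrow> U n x \<le> U (Suc n) x" for n x
  proof (induction n arbitrary: x)
    case 0
    then show ?case using U_bounds[of x 1] by (simp add: U_0)
  next
    case (Suc n)
    then show ?case using bellman_le[of "U n" "U (Suc n)" \<beta> x] \<beta> by (simp add: U_Suc)
  qed
  have "\<exists>l. (\<lambda>n. U n x) \<longlonglongrightarrow> l" if "x \<in> X" for x
    using incseq_convergent[of "\<lambda>n. U n x" B] U_mono[OF that] U_bounds[OF that]
    by (metis incseq_SucI)
  then obtain V where V: "\<And>x. x \<in> X \<Longrightarrow> (\<lambda>n. U n x) \<longlonglongrightarrow> V x" by metis
  have U_shape: "monotone_val (U n) \<and> convex_val (U n)" for n
  proof (induction n)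
    case 0
    then show ?case by (simp add: U_0 monotone_val_def convex_val_def convex_seq_def monotone_on_def)
  qed (simp add: U_Suc bellman_monotone bellman_convex \<beta>)
  show thesis
  proof (rule that[of V])
    fix x assume x: "x \<in> X"
    obtain q a i where xq: "x = (q, a, i)" by (cases x)
    have "(\<lambda>n. bellman \<beta> (U n) x) \<longlonglongrightarrow> bellman \<beta> V x"
      unfolding bellman_def xq prod.case using x xq
      by (intro tendsto_add tendsto_mult tendsto_const infconv_tendsto next_val_tendsto V) (auto simp: mem_X)
    moreover have "(\<lambda>n. bellman \<beta> (U n) x) \<longlonglongrightarrow> V x"
      using LIMSEQ_Suc[OF V[OF x]] by (simp add: U_Suc)
    ultimately show "V x = bellman \<beta> V x" using LIMSEQ_unique by blast
    show "0 \<le> V x" using LIMSEQ_le_const[OF V[OF x]] U_bounds[OF x] by blast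
    show "V x \<le> C / (1 - \<beta>)" using LIMSEQ_le_const2[OF V[OF x]] U_bounds[OF x] unfolding B_def by blast
  next
    show "monotone_val V" by (rule monotone_val_limit[OF _ V]) (simp_all add: U_shape)
    show "convex_val V" by (rule convex_val_limit[OF _ V]) (simp_all add: U_shape)
  qed
qed

end

section \<open>The average-cost optimality equation\<close>

context queue_mdp
begin

lemma \<gamma>_successor:
  assumes "a \<le> A"
  obtains b where "b \<le> A" "0 < \<gamma> a b"
proof -
  have "\<exists>b\<in>{..A}. 0 < \<gamma> a b"
  proof (rule ccontr)
    assume "\<not> ?thesis"
    then have "(\<Sum>b\<le>A. \<gamma> a b) \<le> 0" by (intro sum_nonpos) (auto simp: not_less)
    then show False using sum_\<gamma>[OF assms] by simp
  qed
  then show thesis using that by auto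
qed

text \<open>An average of values not exceeding M can reach M only if every value of positive weight
  equals M.\<close>

lemma next_val_le_maxD:
  assumes a: "a \<le> A" and r: "r \<le> Q - A" and le: "\<And>x. x \<in> X \<Longrightarrow> u x \<le> M"
    and M: "M \<le> next_val u a r"
    and b: "b \<le> A" "0 < \<gamma> a b" and i: "i \<in> {1..L}" "0 < \<eta> i"
  shows "u (r + b, b, i) = M"
proof (rule ccontr)
  assume neq: "u (r + b, b, i) \<noteq> M"
  have "next_val u a r < next_val (\<lambda>_. M) a r"
    unfolding next_val_def sum.cartesian_product
  proof (rule sum_strict_mono_ex1)
    show "\<forall>x\<in>{..A} \<times> {1..L}. (case x of (a', i') \<Rightarrow> \<gamma> a a' * \<eta> i' * u (r + a', a', i'))
        \<le> (case x of (a', i') \<Rightarrow> \<gamma> a a' * \<eta> i' * M)"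
      using a r by (auto intro!: mult_left_mono mult_nonneg_nonneg \<gamma>_nonneg \<eta>_nonneg le next_in_X)
    have "u (r + b, b, i) < M" using neq le[OF next_in_X[OF r b(1) i(1)]] by simp
    then have "\<gamma> a b * \<eta> i * u (r + b, b, i) < \<gamma> a b * \<eta> i * M" using b i by simp
    then show "\<exists>x\<in>{..A} \<times> {1..L}. (case x of (a', i') \<Rightarrow> \<gamma> a a' * \<eta> i' * u (r + a', a', i'))
        < (case x of (a', i') \<Rightarrow> \<gamma> a a' * \<eta> i' * M)"
      using b i by (intro bexI[of _ "(b, i)"]) auto
  qed auto
  then show False using M a by (simp add: next_val_const)
qed

text \<open>Maximum principle: a solution of the optimality equation without costs is maximal along the
  draining policy, which empties the buffer; by monotonicity its value there is also its minimum.\<close>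

lemma costless_solution_constant:
  assumes mono: "monotone_val u"
    and eq: "\<And>q a i. (q, a, i) \<in> X \<Longrightarrow> u (q, a, i) = infconv (\<lambda>_. 0) (next_val u a) q"
  shows "\<exists>c. \<forall>x\<in>X. u x = c"
proof -
  define M where "M = Max (u ` X)"
  have le: "u x \<le> M" if "x \<in> X" for x unfolding M_def using that by simp
  obtain q\<^sub>0 a\<^sub>0 i\<^sub>0 where x0: "(q\<^sub>0, a\<^sub>0, i\<^sub>0) \<in> X" "u (q\<^sub>0, a\<^sub>0, i\<^sub>0) = M"
  proof -
    have "M \<in> u ` X" unfolding M_def using X_nonempty by (intro Max_in) auto
    then show thesis using that by auto
  qed
  \<comment> \<open>At a maximal state the draining rate is a competitor in the minimum, so its
    expected value is at least M; hence all its successors of positive probability are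
    maximal.\<close>
  have drain: "u (q - min q S + b, b, i') = M"
    if "(q, a, i) \<in> X" "u (q, a, i) = M" "b \<le> A" "0 < \<gamma> a b" "i' \<in> {1..L}" "0 < \<eta> i'"
    for q a i b i'
  proof (rule next_val_le_maxD[OF _ _ le _ that(3-6)])
    have s: "min q S \<in> rates q" using that by (auto simp: mem_X intro: min_in_rates)
    then show "q - min q S \<le> Q - A" using A_le_Q by (auto simp: mem_rates)
    show "M \<le> next_val u a (q - min q S)"
      using infconv_le[OF s, of "\<lambda>_. 0" "next_val u a"] eq[OF that(1)] that(2) by simp
    show "a \<le> A" using that by (simp add: mem_X)
  qed
  have at_empty: "u (b, b, i) = M" if b: "b \<le> A" and i: "i \<in> {1..L}" "0 < \<eta> i" for b i
  proof -
    \<comment> \<open>r is the remainder after a transmission and a the following arrivals, with a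
      fixed channel i of positive probability.\<close>
    define R where "R r a \<longleftrightarrow> r \<le> Q - A \<and> a \<le> A \<and> u (r + a, a, i) = M" for r a
    have step: "R (r + a - S) b" if "R r a" "b \<le> A" "0 < \<gamma> a b" for r a b
    proof -
      have "(r + a, a, i) \<in> X" "u (r + a, a, i) = M"
        using that(1) i A_le_Q by (auto simp: R_def mem_X)
      moreover have "r + a - min (r + a) S = r + a - S" "r + a - S \<le> Q - A"
        using that(1) A_le_S by (auto simp: R_def min_def)
      ultimately show ?thesis using drain[of "r + a" a i b i] that(2,3) i by (simp add: R_def)
    qed
    \<comment> \<open>Along a positive path of the arrival chain the remainder never grows, as at
      most A \<le> S packets arrive between two drainings.\<close>
    have reach: "\<exists>r'\<le>r. R r' b"
      if "0 < n_step {..A} \<gamma> n a b" "R r a" "b \<le> A" for n r a b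
      using that
    proof (induction n arbitrary: r a)
      case 0
      then show ?case by (auto split: if_splits)
    next
      case (Suc n)
      have "a \<le> A" using Suc.prems by (simp add: R_def)
      have "\<exists>z\<in>{..A}. 0 < \<gamma> a z * n_step {..A} \<gamma> n z b"
        by (rule ccontr, use Suc.prems(1) in \<open>simp add: not_less\<close>)
          (meson atMost_iff leD sum_nonpos)
      then obtain z where z: "z \<le> A" "0 < \<gamma> a z * n_step {..A} \<gamma> n z b" by auto
      then have "0 < \<gamma> a z" "0 < n_step {..A} \<gamma> n z b"
        using \<gamma>_nonneg[OF \<open>a \<le> A\<close> z(1)] by (auto simp: zero_less_mult_iff)
      then obtain r' where "r' \<le> r + a - S" "R r' b"
        using Suc.IH[OF _ step[OF Suc.prems(2) z(1)] Suc.prems(3)] by auto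
      then show ?case using \<open>a \<le> A\<close> A_le_S by (intro exI[of _ r']) auto
    qed
    have connected: "\<exists>n. 0 < n_step {..A} \<gamma> n a b" if "a \<le> A" "b \<le> A" for a b
      using ergodic that by (auto simp: ergodic_chain_def)
    \<comment> \<open>Steering the arrivals to 0 makes the next transmission remove packets without
      replacement, so a positive remainder drops strictly.\<close>
    have drained: "\<exists>a. R 0 a" if "R r a" for r a
      using that
    proof (induction r arbitrary: a rule: less_induct)
      case (less r)
      obtain n where "0 < n_step {..A} \<gamma> n a 0"
        using connected[of a 0] less.prems by (auto simp: R_def)
      then obtain r' where r': "r' \<le> r" "R r' 0" using reach[OF _ less.prems] by auto
      obtain b where "b \<le> A" "0 < \<gamma> 0 b" using \<gamma>_successor[of 0] by auto
      then have "R (r' - S) b" using step[OF r'(2)] by auto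
      show ?case
      proof (cases "r' - S < r")
        case True
        then show ?thesis using less.IH \<open>R (r' - S) b\<close> by blast
      next
        case False
        then have "r' = 0" using r' A_pos A_le_S by auto
        then show ?thesis using r' by auto
      qed
    qed
    obtain c where c: "c \<le> A" "0 < \<gamma> a\<^sub>0 c" using \<gamma>_successor[of a\<^sub>0] x0 by (auto simp: mem_X)
    have "R (q\<^sub>0 - min q\<^sub>0 S) c"
      unfolding R_def using drain[OF x0 c i] x0 c min_in_rates[of q\<^sub>0] A_le_Q
      by (auto simp: mem_rates mem_X)
    then obtain d where "R 0 d" using drained by blast
    moreover obtain n where "0 < n_step {..A} \<gamma> n d b"
      using connected[of d b] \<open>R 0 d\<close> b by (auto simp: R_def)
    ultimately show ?thesis using reach[of n d b 0] b by (auto simp: R_def)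
  qed
  have "u (q, a, i) = M" if x: "(q, a, i) \<in> X" for q a i
  proof (rule antisym[OF le[OF x]])
    have aA: "a \<le> A" and qQ: "q \<le> Q" using x by (auto simp: mem_X)
    obtain s where s: "s \<in> best (\<lambda>_. 0) (next_val u a) q" using best_nonempty[OF qQ] by blast
    then have r: "q - s \<le> Q - A" using A_le_Q by (auto simp: best_def mem_rates)
    have "M = next_val (\<lambda>_. M) a (q - s)" using aA by (simp add: next_val_const)
    also have "\<dots> \<le> next_val u a (q - s)"
      unfolding next_val_def
    proof (intro sum_mono)
      fix b i' assume b: "b \<in> {..A}" and i': "i' \<in> {1..L}"
      show "\<gamma> a b * \<eta> i' * M \<le> \<gamma> a b * \<eta> i' * u (q - s + b, b, i')"
      \<comment> \<open>Maximality at the empty buffer is known only for channels of positive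
        probability; the others have weight 0 on both sides.\<close>
      proof (cases "\<eta> i' = 0")
        case False
        then have "M = u (b, b, i')" using at_empty b i' \<eta>_nonneg[OF i'] by simp
        also have "\<dots> \<le> u (q - s + b, b, i')"
          using mono b i' r A_le_Q unfolding monotone_val_def
          by (auto intro!: mono_onD[of "{..Q}" "\<lambda>q. u (q, b, i')"])
        finally show ?thesis
          using b aA i' by (intro mult_left_mono mult_nonneg_nonneg \<gamma>_nonneg \<eta>_nonneg) auto
      qed simp
    qed
    also have "\<dots> = u (q, a, i)" using s eq[OF x] by (simp add: best_def)
    finally show "M \<le> u (q, a, i)" .
  qed
  then show ?thesis by (intro exI[of _ M]) auto
qed

text \<open>Along discounts tending to 1, the values are shifted to minimum 0 and divided by their
  span, so a subsequence converges. In the limit equation all costs carry the factor \<kappa> = lim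
  \<open>1 / \<rho>\<close>. If \<kappa> were 0, the limit would solve the costless equation and be
  constant, although the scaled values keep span 1. So \<kappa> > 0, and dividing by it restores the
  true costs.\<close>

lemma optimality_equation:
  obtains g u where "\<And>x. x \<in> X \<Longrightarrow> g + u x = bellman 1 u x" "monotone_val u" "convex_val u"
proof -
  obtain C where C: "\<forall>(q, a, i)\<in>X. \<forall>s\<le>S. w * real q + p i s \<le> C" using cost_bound by blast
  define \<beta> where "\<beta> n = 1 - 1 / (real n + 2)" for n :: nat
  have \<beta>: "0 \<le> \<beta> n" "\<beta> n < 1" for n by (auto simp: \<beta>_def field_simps)
  have "\<forall>n. \<exists>V. (\<forall>x\<in>X. V x = bellman (\<beta> n) V x \<and> 0 \<le> V x \<and> V x \<le> C / (1 - \<beta> n)) \<and>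
      monotone_val V \<and> convex_val V"
    using discounted_value[OF C \<beta>] by metis
  then obtain V where V_eq: "\<And>n x. x \<in> X \<Longrightarrow> V n x = bellman (\<beta> n) (V n) x"
    and V_nonneg: "\<And>n x. x \<in> X \<Longrightarrow> 0 \<le> V n x"
    and V_le: "\<And>n x. x \<in> X \<Longrightarrow> V n x \<le> C / (1 - \<beta> n)"
    and V_shape: "\<And>n. monotone_val (V n)" "\<And>n. convex_val (V n)"
    by metis
  define m where "m n = Min (V n ` X)" for n
  \<comment> \<open>The lower bound 1 keeps \<open>1 / \<rho> n\<close> bounded even when the span
    is small or zero.\<close>
  define \<rho> where "\<rho> n = max 1 (Max (V n ` X) - m n)" for n
  define u where "u n x = (V n x - m n) / \<rho> n" for n x
  have \<rho>: "1 \<le> \<rho> n" for n by (simp add: \<rho>_def)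
  have m_le: "x \<in> X \<Longrightarrow> m n \<le> V n x" and le_Max: "x \<in> X \<Longrightarrow> V n x \<le> Max (V n ` X)" for n x
    by (simp_all add: m_def)
  have u_bounds: "0 \<le> u n x" "u n x \<le> 1" if "x \<in> X" for n x
    using m_le[OF that, of n] le_Max[OF that, of n] \<rho>[of n]
    by (auto simp: u_def \<rho>_def field_simps)
  \<comment> \<open>The average cost g arises as a limit of these bounded numbers.\<close>
  have m_bounds: "0 \<le> (1 - \<beta> n) * m n" "(1 - \<beta> n) * m n \<le> C" for n
  proof -
    obtain x where x: "x \<in> X" "m n = V n x"
    proof -
      have "m n \<in> V n ` X" unfolding m_def using X_nonempty by (intro Min_in) auto
      then show thesis using that by auto
    qed
    show "0 \<le> (1 - \<beta> n) * m n" using V_nonneg[OF x(1), of n] x(2) \<beta>[of n] by simp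
    show "(1 - \<beta> n) * m n \<le> C" using V_le[OF x(1), of n] x(2) \<beta>[of n] by (simp add: field_simps)
  qed
  have u_eq: "u n (q, a, i) = 1 / \<rho> n * (w * real q) +
      infconv (\<lambda>s. 1 / \<rho> n * p i s) (\<lambda>r. \<beta> n * next_val (u n) a r) q - 1 / \<rho> n * ((1 - \<beta> n) * m n)"
    if x: "(q, a, i) \<in> X" for n q a i
  proof -
    have qa: "q \<le> Q" "a \<le> A" using x by (auto simp: mem_X)
    have "V n = (\<lambda>x. \<rho> n * u n x + m n)" using \<rho>[of n] by (auto simp: u_def fun_eq_iff)
    then have "next_val (V n) a r = \<rho> n * next_val (u n) a r + m n" for r
      using next_val_affine[OF qa(2), of "\<rho> n" "u n" "m n"] by simp
    then have "V n (q, a, i) = w * real q +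
        infconv (p i) (\<lambda>r. \<beta> n * (\<rho> n * next_val (u n) a r) + \<beta> n * m n) q"
      using V_eq[OF x, of n] by (simp add: bellman_def distrib_left)
    then have "V n (q, a, i) - m n = w * real q +
        infconv (p i) (\<lambda>r. \<rho> n * (\<beta> n * next_val (u n) a r)) q - (1 - \<beta> n) * m n"
      using infconv_add[OF qa(1), of "p i" "\<lambda>r. \<beta> n * (\<rho> n * next_val (u n) a r)" "\<beta> n * m n"]
      by (simp add: algebra_simps)
    also have "infconv (p i) (\<lambda>r. \<rho> n * (\<beta> n * next_val (u n) a r)) q =
        \<rho> n * infconv (\<lambda>s. 1 / \<rho> n * p i s) (\<lambda>r. \<beta> n * next_val (u n) a r) q"
      using infconv_scale[OF qa(1), of "\<rho> n" "\<lambda>s. 1 / \<rho> n * p i s" "\<lambda>r. \<beta> n * next_val (u n) a r"] \<rho>[of n]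
      by simp
    finally show ?thesis using \<rho>[of n] by (simp add: u_def field_simps)
  qed
  \<comment> \<open>Packing the two scalar sequences into one function on {0, 1} yields a common
    convergent subsequence.\<close>
  define aux where "aux n k = (if k = 0 then 1 / \<rho> n else (1 - \<beta> n) * m n)" for n and k :: nat
  have aux: "\<bar>aux n k\<bar> \<le> max 1 C" for n k
  proof -
    have "1 / \<rho> n \<le> 1" "0 \<le> 1 / \<rho> n" using \<rho>[of n] by auto
    then have "\<bar>1 / \<rho> n\<bar> \<le> max 1 C" by (simp add: le_max_iff_disj)
    then show ?thesis using m_bounds[of n] by (auto simp: aux_def)
  qed
  obtain r\<^sub>1 k where r1: "strict_mono r\<^sub>1" "\<forall>j\<in>{0, 1}. (\<lambda>n. aux (r\<^sub>1 n) j) \<longlonglongrightarrow> k j"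
    using bounded_subsequence_on_finite[of "{0, 1}" aux] aux by (metis finite.intros)
  obtain r\<^sub>2 l where r2: "strict_mono r\<^sub>2" "\<forall>x\<in>X. (\<lambda>n. u (r\<^sub>1 (r\<^sub>2 n)) x) \<longlonglongrightarrow> l x"
    using bounded_subsequence_on_finite[of X "\<lambda>n. u (r\<^sub>1 n)" 1] u_bounds by fastforce
  define r where "r = r\<^sub>1 \<circ> r\<^sub>2"
  have r: "strict_mono r" unfolding r_def using r1(1) r2(1) by (rule strict_mono_o)
  define \<kappa> g where "\<kappa> = k 0" and "g = k 1"
  have lim_\<kappa>: "(\<lambda>n. 1 / \<rho> (r n)) \<longlonglongrightarrow> \<kappa>" and lim_g: "(\<lambda>n. (1 - \<beta> (r n)) * m (r n)) \<longlonglongrightarrow> g"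
    using LIMSEQ_subseq_LIMSEQ[OF r1(2)[rule_format, of 0] r2(1)]
      LIMSEQ_subseq_LIMSEQ[OF r1(2)[rule_format, of 1] r2(1)]
    by (simp_all add: aux_def r_def o_def \<kappa>_def g_def)
  have lim_u: "(\<lambda>n. u (r n) x) \<longlonglongrightarrow> l x" if "x \<in> X" for x
    using r2(2) that by (simp add: r_def)
  have "(\<lambda>n. 1 / (real n + 2)) \<longlonglongrightarrow> 0"
    using LIMSEQ_ignore_initial_segment[OF lim_1_over_n, of 2] by (simp add: add.commute)
  then have "\<beta> \<longlonglongrightarrow> 1"
    unfolding \<beta>_def using tendsto_diff[OF tendsto_const[of 1]] by force
  then have lim_\<beta>: "(\<lambda>n. \<beta> (r n)) \<longlonglongrightarrow> 1"
    using LIMSEQ_subseq_LIMSEQ[OF _ r] by (simp add: o_def)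
  have \<kappa>_nonneg: "0 \<le> \<kappa>"
    using \<rho> by (intro LIMSEQ_le_const[OF lim_\<kappa>]) (auto intro!: exI[of _ 0] divide_nonneg_nonneg order_trans[OF _ \<rho>])
  have u_mono: "monotone_val (u n)" for n
    using V_shape(1)[of n] \<rho>[of n]
    by (auto simp: monotone_val_def monotone_on_def u_def intro!: divide_right_mono)
  have u_convex: "convex_val (u n)" for n
    using V_shape(2)[of n] \<rho>[of n]
    by (auto simp: convex_val_def convex_seq_def u_def diff_divide_distrib[symmetric] intro!: divide_right_mono)
  have l_mono: "monotone_val l" using u_mono by (rule monotone_val_limit[where u = "\<lambda>n. u (r n)"]) (rule lim_u)
  have l_convex: "convex_val l" using u_convex by (rule convex_val_limit[where u = "\<lambda>n. u (r n)"]) (rule lim_u)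
  have l_eq: "l (q, a, i) = \<kappa> * (w * real q) + infconv (\<lambda>s. \<kappa> * p i s) (next_val l a) q - \<kappa> * g"
    if x: "(q, a, i) \<in> X" for q a i
  proof (rule LIMSEQ_unique[OF lim_u[OF x]])
    have "(\<lambda>n. 1 / \<rho> (r n) * (w * real q) +
        infconv (\<lambda>s. 1 / \<rho> (r n) * p i s) (\<lambda>t. \<beta> (r n) * next_val (u (r n)) a t) q -
        1 / \<rho> (r n) * ((1 - \<beta> (r n)) * m (r n)))
      \<longlonglongrightarrow> \<kappa> * (w * real q) + infconv (\<lambda>s. \<kappa> * p i s) (\<lambda>t. 1 * next_val l a t) q - \<kappa> * g"
      using x by (intro tendsto_add tendsto_diff tendsto_mult infconv_tendsto next_val_tendsto
          lim_u lim_\<kappa> lim_g lim_\<beta> tendsto_const) (auto simp: mem_X)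
    then show "(\<lambda>n. u (r n) (q, a, i))
      \<longlonglongrightarrow> \<kappa> * (w * real q) + infconv (\<lambda>s. \<kappa> * p i s) (next_val l a) q - \<kappa> * g"
      using u_eq[OF x] by simp
  qed
  have "\<kappa> \<noteq> 0"
  proof
    assume "\<kappa> = 0"
    then obtain c where c: "\<forall>x\<in>X. l x = c"
      using costless_solution_constant[OF l_mono] l_eq by auto
    have "\<forall>\<^sub>F n in sequentially. \<forall>x\<in>X. dist (u (r n) x) c < 1 / 2"
    proof (intro eventually_ball_finite ballI)
      fix x assume "x \<in> X"
      then show "\<forall>\<^sub>F n in sequentially. dist (u (r n) x) c < 1 / 2"
        using tendstoD[OF lim_u, of x "1 / 2"] c by simp
    qed simp
    moreover have "\<forall>\<^sub>F n in sequentially. 1 / \<rho> (r n) < 1"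
      using lim_\<kappa> \<open>\<kappa> = 0\<close> by (intro order_tendstoD) auto
    ultimately have "\<forall>\<^sub>F n in sequentially. False"
    proof eventually_elim
      case (elim n)
      \<comment> \<open>Now \<rho> is the true span, so the scaled value attains both 0 and 1, and
        these cannot both be within 1/2 of c.\<close>
      then have "1 < \<rho> (r n)" using \<rho>[of "r n"] by (simp add: field_simps)
      then have \<rho>_eq: "\<rho> (r n) = Max (V (r n) ` X) - m (r n)" by (simp add: \<rho>_def max_def split: if_splits)
      obtain x y where "x \<in> X" "y \<in> X" "V (r n) x = Max (V (r n) ` X)" "V (r n) y = m (r n)"
      proof -
        have "Max (V (r n) ` X) \<in> V (r n) ` X" "m (r n) \<in> V (r n) ` X"
          unfolding m_def using X_nonempty by (auto intro!: Max_in Min_in simp del: Max_in Min_in)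
        then show thesis using that by (elim imageE) auto
      qed
      moreover have "u (r n) x = 1" "u (r n) y = 0"
        using calculation \<rho>_eq \<open>1 < \<rho> (r n)\<close> by (auto simp: u_def)
      ultimately have "dist 1 c < 1 / 2" "dist 0 c < 1 / 2" using elim(1) by force+
      then show False by (simp add: dist_real_def)
    qed
    then show False by simp
  qed
  then have \<kappa>: "0 < \<kappa>" using \<kappa>_nonneg by simp
  define h where "h x = l x / \<kappa>" for x
  show thesis
  proof (rule that[of g h])
    fix x assume x: "x \<in> X"
    obtain q a i where xq: "x = (q, a, i)" by (cases x)
    have qa: "q \<le> Q" "a \<le> A" using x xq by (auto simp: mem_X)
    have "l = (\<lambda>x. \<kappa> * h x + 0)" using \<kappa> by (simp add: h_def fun_eq_iff)
    then have "next_val l a = (\<lambda>r. \<kappa> * next_val h a r)"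
      using next_val_affine[OF qa(2), of \<kappa> h 0] by auto
    then have "\<kappa> * h x = \<kappa> * (w * real q) + \<kappa> * infconv (p i) (next_val h a) q - \<kappa> * g"
      using l_eq[of q a i] x xq infconv_scale[OF qa(1) \<kappa>, of "p i" "next_val h a"] \<kappa>
      by (simp add: h_def)
    then have "\<kappa> * (g + h x) = \<kappa> * bellman 1 h x" by (simp add: bellman_def xq algebra_simps)
    then show "g + h x = bellman 1 h x" using \<kappa> by simp
  next
    show "monotone_val h"
      using l_mono \<kappa> by (auto simp: monotone_val_def monotone_on_def h_def intro!: divide_right_mono)
    show "convex_val h"
      using l_convex \<kappa>
      by (auto simp: convex_val_def convex_seq_def h_def diff_divide_distrib[symmetric] intro!: divide_right_mono)
  qed
qed

end

section \<open>Stationary distributions and mixtures of policies\<close>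

text \<open>Cesaro averages of the laws started in \<mu> have a convergent subsequence with
  stationary limit. Since U is closed under the kernel, the one-step inequality propagates: the n-th
  law integrates u at least as high as \<mu> does, and so do the averages and their limit.\<close>

lemma stationary_distribution_above:
  fixes \<mu> :: "'a \<Rightarrow> real"
  assumes X: "finite X" and K: "transition_probs X K"
    and \<mu>: "\<And>x. x \<in> X \<Longrightarrow> 0 \<le> \<mu> x" "(\<Sum>x\<in>X. \<mu> x) = 1"
    and U: "\<And>u. u \<in> U \<Longrightarrow> (\<lambda>x. \<Sum>y\<in>X. K x y * u y) \<in> U"
    and U_le: "\<And>u. u \<in> U \<Longrightarrow> (\<Sum>x\<in>X. \<mu> x * u x) \<le> (\<Sum>x\<in>X. \<mu> x * (\<Sum>y\<in>X. K x y * u y))"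
  obtains \<pi> where "stationary_distribution X K \<pi>"
    "\<And>u. u \<in> U \<Longrightarrow> (\<Sum>x\<in>X. \<mu> x * u x) \<le> (\<Sum>x\<in>X. \<pi> x * u x)"
proof -
  define push where "push \<nu> = (\<lambda>y. \<Sum>x\<in>X. \<nu> x * K x y)" for \<nu> :: "'a \<Rightarrow> real"
  have push_sum: "(\<Sum>y\<in>X. push \<nu> y * u y) = (\<Sum>x\<in>X. \<nu> x * (\<Sum>y\<in>X. K x y * u y))" for \<nu> u
    unfolding push_def sum_distrib_left sum_distrib_right
    by (subst sum.swap) (simp add: mult.assoc)
  define m where "m n = (push ^^ n) \<mu>" for n
  have m_0: "m 0 = \<mu>" and m_Suc: "m (Suc n) = push (m n)" for n by (simp_all add: m_def)
  have m_dist: "(\<forall>x\<in>X. 0 \<le> m n x) \<and> (\<Sum>x\<in>X. m n x) = 1" for n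
  proof (induction n)
    case (Suc n)
    have "(\<Sum>y\<in>X. push (m n) y) = (\<Sum>x\<in>X. m n x * (\<Sum>y\<in>X. K x y))"
      using push_sum[of "m n" "\<lambda>_. 1"] by simp
    also have "\<dots> = (\<Sum>x\<in>X. m n x)" using K by (simp add: transition_probs_def)
    finally show ?case using Suc K
      by (auto simp: m_Suc push_def transition_probs_def intro!: sum_nonneg)
  qed (use \<mu> in \<open>simp add: m_0\<close>)
  have m_U: "u \<in> U \<Longrightarrow> (\<Sum>x\<in>X. \<mu> x * u x) \<le> (\<Sum>x\<in>X. m n x * u x)" for n u
  proof (induction n arbitrary: u)
    case (Suc n)
    show ?case using U_le[OF Suc.prems] Suc.IH[OF U[OF Suc.prems]]
      by (simp add: m_Suc push_sum)
  qed (simp add: m_0)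
  define \<nu> where "\<nu> N x = (\<Sum>n\<le>N. m n x) / real (Suc N)" for N x
  have \<nu>_sum: "(\<Sum>x\<in>X. \<nu> N x * u x) = (\<Sum>n\<le>N. \<Sum>x\<in>X. m n x * u x) / real (Suc N)" for N u
    unfolding \<nu>_def by (subst sum.swap) (simp add: sum_distrib_right sum_divide_distrib)
  have \<nu>_nonneg: "0 \<le> \<nu> N x" if "x \<in> X" for N x
    using m_dist that by (auto simp: \<nu>_def intro!: divide_nonneg_nonneg sum_nonneg)
  have \<nu>_1: "(\<Sum>x\<in>X. \<nu> N x) = 1" for N
    using \<nu>_sum[of N "\<lambda>_. 1"] m_dist by (simp del: of_nat_Suc)
  have "\<bar>\<nu> N x\<bar> \<le> 1" if "x \<in> X" for N x
    using member_le_sum[of x X "\<nu> N"] that X \<nu>_nonneg \<nu>_1[of N] by auto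
  then obtain r \<pi> where r: "strict_mono r" and lim: "\<forall>x\<in>X. (\<lambda>n. \<nu> (r n) x) \<longlonglongrightarrow> \<pi> x"
    using bounded_subsequence_on_finite[OF X] by metis
  have lim_sum: "(\<lambda>n. \<Sum>x\<in>X. \<nu> (r n) x * u x) \<longlonglongrightarrow> (\<Sum>x\<in>X. \<pi> x * u x)" for u
    using lim by (intro tendsto_sum tendsto_mult tendsto_const) auto
  have "(\<Sum>x\<in>X. \<pi> x * K x y) = \<pi> y" if y: "y \<in> X" for y
  proof -
    \<comment> \<open>The balance defect of an average telescopes to two terms divided by N + 1, so
      it vanishes in the limit.\<close>
    have diff: "(\<Sum>x\<in>X. \<nu> N x * K x y) - \<nu> N y = (m (Suc N) y - m 0 y) / real (Suc N)" for N
    proof -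
      have "(\<Sum>x\<in>X. \<nu> N x * K x y) = (\<Sum>n\<le>N. m (Suc n) y) / real (Suc N)"
        unfolding \<nu>_sum by (simp add: m_Suc push_def)
      moreover have "(\<Sum>n\<le>N. m (Suc n) y) - (\<Sum>n\<le>N. m n y) = m (Suc N) y - m 0 y"
        unfolding sum_subtractf[symmetric] by (induction N) auto
      ultimately show ?thesis by (simp add: \<nu>_def diff_divide_distrib[symmetric])
    qed
    have m_le: "0 \<le> m n y \<and> m n y \<le> 1" for n
      using member_le_sum[of y X "m n"] y X m_dist[of n] by auto
    have "(\<lambda>N. (\<Sum>x\<in>X. \<nu> N x * K x y) - \<nu> N y) \<longlonglongrightarrow> 0"
    proof (rule tendsto_rabs_zero_cancel, rule tendsto_sandwich[of "\<lambda>_. 0"])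
      show "\<forall>\<^sub>F N in sequentially. \<bar>(\<Sum>x\<in>X. \<nu> N x * K x y) - \<nu> N y\<bar> \<le> inverse (real (Suc N))"
      proof (intro always_eventually allI)
        fix N
        have "\<bar>m (Suc N) y - m 0 y\<bar> \<le> 1" using m_le[of 0] m_le[of "Suc N"] by linarith
        then show "\<bar>(\<Sum>x\<in>X. \<nu> N x * K x y) - \<nu> N y\<bar> \<le> inverse (real (Suc N))"
          unfolding diff by (simp add: divide_simps)
      qed
    qed (simp_all add: LIMSEQ_inverse_real_of_nat del: of_nat_Suc)
    then have "(\<lambda>n. (\<Sum>x\<in>X. \<nu> (r n) x * K x y) - \<nu> (r n) y) \<longlonglongrightarrow> 0"
      using LIMSEQ_subseq_LIMSEQ[OF _ r] by (fastforce simp: o_def)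
    moreover have "(\<lambda>n. (\<Sum>x\<in>X. \<nu> (r n) x * K x y) - \<nu> (r n) y) \<longlonglongrightarrow> (\<Sum>x\<in>X. \<pi> x * K x y) - \<pi> y"
      using lim y by (intro tendsto_diff lim_sum) auto
    ultimately show ?thesis using LIMSEQ_unique by fastforce
  qed
  moreover have "0 \<le> \<pi> x" if "x \<in> X" for x
    using LIMSEQ_le_const[OF lim[rule_format, OF that]] \<nu>_nonneg[OF that] by blast
  moreover have "(\<Sum>x\<in>X. \<pi> x) = 1"
    using LIMSEQ_unique[OF lim_sum[of "\<lambda>_. 1"]] \<nu>_1 by simp
  ultimately have "stationary_distribution X K \<pi>" by (simp add: stationary_distribution_def)
  moreover have "(\<Sum>x\<in>X. \<mu> x * u x) \<le> (\<Sum>x\<in>X. \<pi> x * u x)" if "u \<in> U" for u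
  proof (rule LIMSEQ_le_const[OF lim_sum], intro exI[of _ 0] allI impI)
    fix n
    have "(\<Sum>k\<le>r n. \<Sum>x\<in>X. \<mu> x * u x) \<le> (\<Sum>k\<le>r n. \<Sum>x\<in>X. m k x * u x)"
      by (intro sum_mono m_U that)
    then show "(\<Sum>x\<in>X. \<mu> x * u x) \<le> (\<Sum>x\<in>X. \<nu> (r n) x * u x)"
      unfolding \<nu>_sum by (simp add: pos_le_divide_eq mult.commute del: of_nat_Suc)
  qed
  ultimately show thesis by (rule that)
qed

section \<open>Policies and expectations under stationarity\<close>

definition deterministic :: "(nat \<Rightarrow> nat \<Rightarrow> nat \<Rightarrow> nat) \<Rightarrow> policy" where
  "deterministic \<sigma> = (\<lambda>q a i s. if s = \<sigma> q a i then 1 else 0)"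

context queue_mdp
begin

abbreviation policy :: "policy \<Rightarrow> bool" where
  "policy \<equiv> is_policy A S Q L"

definition stationary :: "policy \<Rightarrow> (nat \<times> nat \<times> nat \<Rightarrow> real) \<Rightarrow> bool" where
  "stationary f \<pi> \<longleftrightarrow> stationary_distribution X (system_step S \<gamma> \<eta> f) \<pi>"

lemma policyD:
  assumes "policy f" "(q, a, i) \<in> X"
  shows policy_nonneg: "s \<le> S \<Longrightarrow> 0 \<le> f q a i s" and policy_sum: "(\<Sum>s\<le>S. f q a i s) = 1"
    and policy_rates: "f q a i s \<noteq> 0 \<Longrightarrow> s \<in> rates q"
  using assms unfolding is_policy_def mem_X by blast+

lemma stationaryD:
  assumes "stationary f \<pi>"
  shows stationary_nonneg: "x \<in> X \<Longrightarrow> 0 \<le> \<pi> x" and stationary_sum: "(\<Sum>x\<in>X. \<pi> x) = 1"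
    and stationary_balance: "y \<in> X \<Longrightarrow> (\<Sum>x\<in>X. \<pi> x * system_step S \<gamma> \<eta> f x y) = \<pi> y"
  using assms by (auto simp: stationary_def stationary_distribution_def)

lemma step_expectation:
  assumes f: "policy f" and x: "(q, a, i) \<in> X"
  shows "(\<Sum>y\<in>X. system_step S \<gamma> \<eta> f (q, a, i) y * u y) =
    (\<Sum>s\<le>S. f q a i s * next_val u a (q - s))"
proof -
  have X_eq: "X = {..Q} \<times> ({..A} \<times> {1..L})" by (simp add: states_def)
  have "(\<Sum>y\<in>X. system_step S \<gamma> \<eta> f (q, a, i) y * u y) =
      (\<Sum>s\<le>S. \<Sum>(q', a', i')\<in>X. if q' + s = q + a' then f q a i s * \<gamma> a a' * \<eta> i' * u (q', a', i') else 0)"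
    by (subst sum.swap)
      (auto simp: system_step_def sum_distrib_right case_prod_unfold intro!: sum.cong)
  also have "\<dots> = (\<Sum>s\<le>S. f q a i s * next_val u a (q - s))"
  proof (rule sum.cong[OF refl])
    fix s assume "s \<in> {..S}"
    show "(\<Sum>(q', a', i')\<in>X. if q' + s = q + a' then f q a i s * \<gamma> a a' * \<eta> i' * u (q', a', i') else 0) =
        f q a i s * next_val u a (q - s)"
    proof (cases "f q a i s = 0")
      case True
      then show ?thesis by (auto intro!: sum.neutral)
    next
      case False
      \<comment> \<open>For a feasible rate the subtraction q - s is not truncated and q - s + a'
        stays within the buffer, so the sum over q' has exactly one term.\<close>
      then have s: "s \<le> q" "q - s + A \<le> Q"
        using policy_rates[OF f x False] by (auto simp: mem_rates)
      have "(\<Sum>(q', a', i')\<in>X. if q' + s = q + a' then f q a i s * \<gamma> a a' * \<eta> i' * u (q', a', i') else 0) =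
          (\<Sum>q'\<le>Q. \<Sum>(a', i')\<in>{..A} \<times> {1..L}.
            if q' + s = q + a' then f q a i s * \<gamma> a a' * \<eta> i' * u (q', a', i') else 0)"
        unfolding X_eq by (rule sum.cartesian_product[symmetric])
      also have "\<dots> = (\<Sum>(a', i')\<in>{..A} \<times> {1..L}. \<Sum>q'\<le>Q.
            if q' = q - s + a' then f q a i s * \<gamma> a a' * \<eta> i' * u (q', a', i') else 0)"
      proof (subst sum.swap)
        have "q' + s = q + a' \<longleftrightarrow> q' = q - s + a'" for q' a' using s by auto
        then show "(\<Sum>z\<in>{..A} \<times> {1..L}. \<Sum>q'\<le>Q. case z of (a', i') \<Rightarrow>
            if q' + s = q + a' then f q a i s * \<gamma> a a' * \<eta> i' * u (q', a', i') else 0) =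
          (\<Sum>(a', i')\<in>{..A} \<times> {1..L}. \<Sum>q'\<le>Q.
            if q' = q - s + a' then f q a i s * \<gamma> a a' * \<eta> i' * u (q', a', i') else 0)"
          by (simp only: case_prod_unfold)
      qed
      also have "\<dots> = (\<Sum>(a', i')\<in>{..A} \<times> {1..L}. f q a i s * \<gamma> a a' * \<eta> i' * u (q - s + a', a', i'))"
        using s by (intro sum.cong) auto
      also have "\<dots> = f q a i s * next_val u a (q - s)"
        unfolding next_val_def sum.cartesian_product sum_distrib_left
        by (auto intro!: sum.cong simp: mult.assoc)
      finally show ?thesis .
    qed
  qed
  finally show ?thesis .
qed

lemma step_transition_probs:
  assumes "policy f"
  shows "transition_probs X (system_step S \<gamma> \<eta> f)"
  unfolding transition_probs_def
proof (intro ballI conjI)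
  fix x y assume xy: "x \<in> X" "y \<in> X"
  obtain q a i q' a' i' where x: "x = (q, a, i)" and y: "y = (q', a', i')" by (cases x, cases y)
  have "0 \<le> f q a i s * \<gamma> a a' * \<eta> i'" if "s \<le> S" for s
    using xy x y that policy_nonneg[OF assms, of q a i s]
    by (intro mult_nonneg_nonneg \<gamma>_nonneg \<eta>_nonneg) (auto simp: mem_X)
  then show "0 \<le> system_step S \<gamma> \<eta> f x y"
    by (auto simp: x y system_step_def intro!: sum_nonneg)
next
  fix x assume x: "x \<in> X"
  obtain q a i where xq: "x = (q, a, i)" by (cases x)
  show "(\<Sum>y\<in>X. system_step S \<gamma> \<eta> f x y) = 1"
    using step_expectation[OF assms, of q a i "\<lambda>_. 1"] x xq policy_sum[OF assms, of q a i]
    by (simp add: next_val_const mem_X)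
qed

lemma stationary_expectation:
  assumes f: "policy f" and \<pi>: "stationary f \<pi>"
  shows "(\<Sum>(q, a, i)\<in>X. \<pi> (q, a, i) * (\<Sum>s\<le>S. f q a i s * next_val u a (q - s))) = (\<Sum>x\<in>X. \<pi> x * u x)"
proof -
  have "(\<Sum>x\<in>X. \<pi> x * u x) = (\<Sum>y\<in>X. (\<Sum>x\<in>X. \<pi> x * system_step S \<gamma> \<eta> f x y) * u y)"
    using stationary_balance[OF \<pi>] by simp
  also have "\<dots> = (\<Sum>x\<in>X. \<pi> x * (\<Sum>y\<in>X. system_step S \<gamma> \<eta> f x y * u y))"
    unfolding sum_distrib_left sum_distrib_right by (subst sum.swap) (simp add: mult.assoc)
  also have "\<dots> = (\<Sum>(q, a, i)\<in>X. \<pi> (q, a, i) * (\<Sum>s\<le>S. f q a i s * next_val u a (q - s)))"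
    by (rule sum.cong) (auto simp: step_expectation[OF f])
  finally show ?thesis by simp
qed

lemma deterministic_policy:
  assumes "\<And>q a i. (q, a, i) \<in> X \<Longrightarrow> \<sigma> q a i \<in> rates q"
  shows "policy (deterministic \<sigma>)"
  using assms by (fastforce simp: is_policy_def deterministic_def mem_X mem_rates)

lemma deterministic_sum:
  "\<sigma> q a i \<le> S \<Longrightarrow> (\<Sum>s\<le>S. deterministic \<sigma> q a i s * v s) = v (\<sigma> q a i)"
  by (simp add: deterministic_def if_distrib[of "\<lambda>c. c * _"] cong: if_cong)

lemma policy_mean_le:
  assumes f: "policy f" and x: "(q, a, i) \<in> X" and le: "\<And>s. 0 < f q a i s \<Longrightarrow> s \<in> rates q \<Longrightarrow> v s \<le> c"
  shows "(\<Sum>s\<le>S. f q a i s * v s) \<le> (c :: real)"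
proof -
  have "(\<Sum>s\<le>S. f q a i s * v s) \<le> (\<Sum>s\<le>S. f q a i s * c)"
  proof (rule sum_mono)
    fix s assume "s \<in> {..S}"
    then show "f q a i s * v s \<le> f q a i s * c"
      using policy_nonneg[OF f x, of s] policy_rates[OF f x, of s] le[of s]
      by (cases "f q a i s = 0") auto
  qed
  also have "\<dots> = c" using policy_sum[OF f x] by (simp add: sum_distrib_right[symmetric])
  finally show ?thesis .
qed

lemma stationary_exists:
  assumes "policy f"
  obtains \<pi> where "stationary f \<pi>"
proof -
  have "stationary_distribution X (system_step S \<gamma> \<eta> f) \<pi> \<Longrightarrow> thesis" for \<pi>
    using that by (simp add: stationary_def)
  \<comment> \<open>Start from the uniform distribution; the empty family asks for no
    inequality.\<close>
  then show thesis
    using stationary_distribution_above[OF finite_X step_transition_probs[OF assms],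
        of "\<lambda>x. 1 / real (card X)" "{}"] X_nonempty by auto
qed

section \<open>Comparison of mean queue lengths\<close>

definition mean_queue :: "(nat \<times> nat \<times> nat \<Rightarrow> real) \<Rightarrow> real" where
  "mean_queue \<pi> = (\<Sum>(q, a, i)\<in>X. real q * \<pi> (q, a, i))"

text \<open>Comparison of a policy with a deterministic one that always transmits less (\<open>e = 1\<close>) or
  always transmits more (\<open>e = -1\<close>).  No coupling is needed: started from the stationary
  distribution of the former, the chain of the latter has expectations of monotone (antitone)
  functions that never fall below the initial one.\<close>

lemma comparison_policy:
  fixes e :: real
  assumes f: "policy f" and \<pi>: "stationary f \<pi>"
    and \<sigma>: "\<And>q a i. (q, a, i) \<in> X \<Longrightarrow> \<sigma> q a i \<in> rates q"
    and rest: "\<And>a i. a \<le> A \<Longrightarrow> i \<in> {1..L} \<Longrightarrow> mono_on {..Q} (\<lambda>q. q - \<sigma> q a i)"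
    and e: "e = 1 \<or> e = - 1"
    and order: "\<And>q a i s. (q, a, i) \<in> X \<Longrightarrow> 0 < \<pi> (q, a, i) \<Longrightarrow> 0 < f q a i s \<Longrightarrow>
      e * real (\<sigma> q a i) \<le> e * real s"
  obtains \<pi>' where "stationary (deterministic \<sigma>) \<pi>'" "e * mean_queue \<pi> \<le> e * mean_queue \<pi>'"
proof -
  have pol: "policy (deterministic \<sigma>)" using \<sigma> by (rule deterministic_policy)
  have step: "(\<Sum>y\<in>X. system_step S \<gamma> \<eta> (deterministic \<sigma>) (q, a, i) y * u y) = next_val u a (q - \<sigma> q a i)"
    if "(q, a, i) \<in> X" for q a i u
    using step_expectation[OF pol that] \<sigma>[OF that] by (simp add: deterministic_sum mem_rates)
  have range: "q - s \<le> Q - A" if "s \<in> rates q" for q s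
    using that A_le_Q by (auto simp: mem_rates)
  have next_mono: "e * next_val u a r \<le> e * next_val u a t"
    if "monotone_val (\<lambda>x. e * u x)" "a \<le> A" "r \<le> t" "t \<le> Q - A" for u a r t
    using mono_onD[OF next_val_mono[OF that(1,2)], of r t] that next_val_affine[OF that(2), of e u 0]
    by auto
  obtain \<pi>' where \<pi>': "stationary_distribution X (system_step S \<gamma> \<eta> (deterministic \<sigma>)) \<pi>'"
    and le: "\<And>u. u \<in> {u. monotone_val (\<lambda>x. e * u x)} \<Longrightarrow> (\<Sum>x\<in>X. \<pi> x * u x) \<le> (\<Sum>x\<in>X. \<pi>' x * u x)"
  proof (rule stationary_distribution_above[OF finite_X step_transition_probs[OF pol]])
    show "0 \<le> \<pi> x" if "x \<in> X" for x using stationary_nonneg[OF \<pi> that] .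
    show "sum \<pi> X = 1" using stationary_sum[OF \<pi>] .
  next
    fix u assume "u \<in> {u. monotone_val (\<lambda>x. e * u x)}"
    then have u: "monotone_val (\<lambda>x. e * u x)" by simp
    \<comment> \<open>The kernel preserves this family because, by \<open>rest\<close>, a longer
      queue leaves a remainder at least as long.\<close>
    show "(\<lambda>x. \<Sum>y\<in>X. system_step S \<gamma> \<eta> (deterministic \<sigma>) x y * u y) \<in> {u. monotone_val (\<lambda>x. e * u x)}"
      unfolding mem_Collect_eq monotone_val_def
    proof (intro allI ballI impI mono_onI)
      fix a i q q' assume *: "a \<le> A" "i \<in> {1..L}" "q \<in> {..Q}" "q' \<in> {..Q}" "q \<le> q'"
      then have x: "(q, a, i) \<in> X" "(q', a, i) \<in> X" by (auto simp: mem_X)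
      show "e * (\<Sum>y\<in>X. system_step S \<gamma> \<eta> (deterministic \<sigma>) (q, a, i) y * u y)
          \<le> e * (\<Sum>y\<in>X. system_step S \<gamma> \<eta> (deterministic \<sigma>) (q', a, i) y * u y)"
        unfolding step[OF x(1)] step[OF x(2)]
        using * x by (intro next_mono[OF u] mono_onD[OF rest]) (auto intro!: range \<sigma>)
    qed
    have "(\<Sum>x\<in>X. \<pi> x * u x) =
        (\<Sum>(q, a, i)\<in>X. \<pi> (q, a, i) * (\<Sum>s\<le>S. f q a i s * next_val u a (q - s)))"
      using stationary_expectation[OF f \<pi>] by simp
    also have "\<dots> \<le> (\<Sum>(q, a, i)\<in>X. \<pi> (q, a, i) * next_val u a (q - \<sigma> q a i))"
    proof (rule sum_mono, clarify)
      fix q a i assume x: "(q, a, i) \<in> X"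
      show "\<pi> (q, a, i) * (\<Sum>s\<le>S. f q a i s * next_val u a (q - s)) \<le> \<pi> (q, a, i) * next_val u a (q - \<sigma> q a i)"
      \<comment> \<open>States of mass 0 contribute nothing; this is why \<open>order\<close> is
        demanded only on the support of \<pi>.\<close>
      proof (cases "\<pi> (q, a, i) = 0")
        case False
        then have pos: "0 < \<pi> (q, a, i)"
          using stationary_nonneg[OF \<pi> x] by (simp add: less_le)
        have "(\<Sum>s\<le>S. f q a i s * next_val u a (q - s)) \<le> next_val u a (q - \<sigma> q a i)"
        proof (rule policy_mean_le[OF f x])
          fix s assume s: "0 < f q a i s" "s \<in> rates q"
          have a: "a \<le> A" using x by (simp add: mem_X)
          show "next_val u a (q - s) \<le> next_val u a (q - \<sigma> q a i)"
            using e
          proof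
            assume "e = 1"
            then show ?thesis
              using next_mono[OF u a, of "q - s" "q - \<sigma> q a i"] order[OF x pos s(1)] range[OF \<sigma>[OF x]]
              by simp
          next
            assume "e = - 1"
            then show ?thesis
              using next_mono[OF u a, of "q - \<sigma> q a i" "q - s"] order[OF x pos s(1)] range[OF s(2)]
              by simp
          qed
        qed
        then show ?thesis using pos by simp
      qed simp
    qed
    also have "\<dots> = (\<Sum>x\<in>X. \<pi> x * (\<Sum>y\<in>X. system_step S \<gamma> \<eta> (deterministic \<sigma>) x y * u y))"
      by (rule sum.cong) (auto simp: step)
    finally show "(\<Sum>x\<in>X. \<pi> x * u x)
        \<le> (\<Sum>x\<in>X. \<pi> x * (\<Sum>y\<in>X. system_step S \<gamma> \<eta> (deterministic \<sigma>) x y * u y))" .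
  qed (rule that)
  \<comment> \<open>Since e squared is 1, this function belongs to the family, and its integral is e
    times the mean queue length.\<close>
  define v where "v = (\<lambda>(q :: nat, a :: nat, i :: nat). e * real q)"
  have "monotone_val (\<lambda>x. e * v x)"
    using e by (auto simp: monotone_val_def monotone_on_def v_def)
  then have "(\<Sum>x\<in>X. \<pi> x * v x) \<le> (\<Sum>x\<in>X. \<pi>' x * v x)" by (intro le) simp
  moreover have "e * mean_queue \<nu> = (\<Sum>x\<in>X. \<nu> x * v x)" for \<nu>
    unfolding mean_queue_def sum_distrib_left v_def by (intro sum.cong) auto
  ultimately have "e * mean_queue \<pi> \<le> e * mean_queue \<pi>'" by simp
  then show thesis using that \<pi>' by (simp add: stationary_def)
qed

section \<open>Convex combinations of stationary policies\<close>

definition mean_power :: "policy \<Rightarrow> (nat \<times> nat \<times> nat \<Rightarrow> real) \<Rightarrow> real" where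
  "mean_power f \<pi> = (\<Sum>(q, a, i)\<in>X. \<Sum>s\<le>S. p i s * \<pi> (q, a, i) * f q a i s)"

text \<open>Feasible stationary pairs \<open>(f, \<pi>)\<close> correspond to points \<open>\<pi> f\<close> of a polytope; this is its
  convexity.\<close>

lemma mixture:
  fixes \<theta> :: real
  assumes f: "policy f\<^sub>1" "policy f\<^sub>2" and \<pi>: "stationary f\<^sub>1 \<pi>\<^sub>1" "stationary f\<^sub>2 \<pi>\<^sub>2"
    and \<theta>: "0 \<le> \<theta>" "\<theta> \<le> 1"
  obtains f \<pi> where "policy f" "stationary f \<pi>"
    "\<And>q a i. (q, a, i) \<in> X \<Longrightarrow> \<exists>\<kappa>. 0 \<le> \<kappa> \<and> \<kappa> \<le> 1 \<and> (\<forall>s. f q a i s = \<kappa> * f\<^sub>1 q a i s + (1 - \<kappa>) * f\<^sub>2 q a i s)"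
    "mean_queue \<pi> = \<theta> * mean_queue \<pi>\<^sub>1 + (1 - \<theta>) * mean_queue \<pi>\<^sub>2"
    "mean_power f \<pi> = \<theta> * mean_power f\<^sub>1 \<pi>\<^sub>1 + (1 - \<theta>) * mean_power f\<^sub>2 \<pi>\<^sub>2"
proof -
  define \<pi> where "\<pi> x = \<theta> * \<pi>\<^sub>1 x + (1 - \<theta>) * \<pi>\<^sub>2 x" for x
  \<comment> \<open>The conditional weight of the first component given the state. Where the mixed
    mass is 0 any weight in [0, 1] will do; 1 is chosen.\<close>
  define \<kappa> where "\<kappa> x = (if \<pi> x = 0 then 1 else \<theta> * \<pi>\<^sub>1 x / \<pi> x)" for x
  define f where "f q a i s = \<kappa> (q, a, i) * f\<^sub>1 q a i s + (1 - \<kappa> (q, a, i)) * f\<^sub>2 q a i s" for q a i s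
  have nonneg: "0 \<le> \<theta> * \<pi>\<^sub>1 x" "0 \<le> (1 - \<theta>) * \<pi>\<^sub>2 x" if "x \<in> X" for x
    using stationary_nonneg[OF \<pi>(1) that] stationary_nonneg[OF \<pi>(2) that] \<theta> by auto
  have \<pi>_nonneg: "0 \<le> \<pi> x" if "x \<in> X" for x
    using nonneg[OF that] by (simp add: \<pi>_def)
  have \<kappa>_bounds: "0 \<le> \<kappa> x" "\<kappa> x \<le> 1" if "x \<in> X" for x
    using nonneg[OF that] \<pi>_nonneg[OF that] by (auto simp: \<kappa>_def \<pi>_def divide_le_eq)
  \<comment> \<open>Balance and power see f only through \<pi> f, and there the mixture is linear
    although f itself is not.\<close>
  have f_eq: "\<pi> (q, a, i) * f q a i s = \<theta> * (\<pi>\<^sub>1 (q, a, i) * f\<^sub>1 q a i s) + (1 - \<theta>) * (\<pi>\<^sub>2 (q, a, i) * f\<^sub>2 q a i s)"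
    if "(q, a, i) \<in> X" for q a i s
  proof (cases "\<pi> (q, a, i) = 0")
    case True
    then have "\<theta> * \<pi>\<^sub>1 (q, a, i) = 0" "(1 - \<theta>) * \<pi>\<^sub>2 (q, a, i) = 0"
      using nonneg[OF that] unfolding \<pi>_def by linarith+
    then show ?thesis using True by (auto simp: mult.assoc[symmetric])
  next
    case False
    then have "\<pi> (q, a, i) * \<kappa> (q, a, i) = \<theta> * \<pi>\<^sub>1 (q, a, i)"
      "\<pi> (q, a, i) * (1 - \<kappa> (q, a, i)) = (1 - \<theta>) * \<pi>\<^sub>2 (q, a, i)"
      by (simp_all add: \<kappa>_def \<pi>_def field_simps)
    then show ?thesis by (simp add: f_def distrib_left mult.assoc[symmetric])
  qed
  show thesis
  proof (rule that[of f \<pi>])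
    show "policy f"
      unfolding is_policy_def
    proof (intro allI ballI impI conjI)
      fix q a i assume "q \<le> Q" "a \<le> A" "i \<in> {1..L}"
      then have x: "(q, a, i) \<in> X" by (simp add: mem_X)
      show "0 \<le> f q a i s" if "s \<le> S" for s
        using policy_nonneg[OF f(1) x that] policy_nonneg[OF f(2) x that] \<kappa>_bounds[OF x] by (simp add: f_def)
      show "(\<Sum>s\<le>S. f q a i s) = 1"
        using policy_sum[OF f(1) x] policy_sum[OF f(2) x]
        by (simp add: f_def sum.distrib sum_distrib_left[symmetric])
      show "f q a i s = 0" if "s \<notin> rates q" for s
      proof -
        have "f\<^sub>1 q a i s = 0" "f\<^sub>2 q a i s = 0"
          using policy_rates[OF f(1) x] policy_rates[OF f(2) x] that by blast+
        then show ?thesis by (simp add: f_def)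
      qed
    qed
    have step: "\<pi> x * system_step S \<gamma> \<eta> f x y = \<theta> * (\<pi>\<^sub>1 x * system_step S \<gamma> \<eta> f\<^sub>1 x y)
        + (1 - \<theta>) * (\<pi>\<^sub>2 x * system_step S \<gamma> \<eta> f\<^sub>2 x y)" if "x \<in> X" for x y
    proof -
      obtain q a i q' a' i' where x: "x = (q, a, i)" and y: "y = (q', a', i')" by (cases x, cases y)
      have "\<pi> x * (if q' + s = q + a' then f q a i s * \<gamma> a a' * \<eta> i' else 0) =
          \<theta> * (\<pi>\<^sub>1 x * (if q' + s = q + a' then f\<^sub>1 q a i s * \<gamma> a a' * \<eta> i' else 0)) +
          (1 - \<theta>) * (\<pi>\<^sub>2 x * (if q' + s = q + a' then f\<^sub>2 q a i s * \<gamma> a a' * \<eta> i' else 0))" for s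
      proof (cases "q' + s = q + a'")
        case True
        have "\<pi> x * (f q a i s * \<gamma> a a' * \<eta> i') = (\<pi> x * f q a i s) * (\<gamma> a a' * \<eta> i')" by simp
        also have "\<dots> = \<theta> * (\<pi>\<^sub>1 x * (f\<^sub>1 q a i s * \<gamma> a a' * \<eta> i')) + (1 - \<theta>) * (\<pi>\<^sub>2 x * (f\<^sub>2 q a i s * \<gamma> a a' * \<eta> i'))"
          unfolding x f_eq[OF that[unfolded x]] by (simp add: algebra_simps)
        finally show ?thesis using True by simp
      qed simp
      then show ?thesis
        by (simp add: x y system_step_def sum_distrib_left sum.distrib[symmetric])
    qed
    show "stationary f \<pi>"
      unfolding stationary_def stationary_distribution_def
    proof (intro conjI ballI)
      show "sum \<pi> X = 1"
        using stationary_sum[OF \<pi>(1)] stationary_sum[OF \<pi>(2)]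
        by (simp add: \<pi>_def sum.distrib sum_distrib_left[symmetric])
      fix y assume "y \<in> X"
      have "(\<Sum>x\<in>X. \<pi> x * system_step S \<gamma> \<eta> f x y) =
          (\<Sum>x\<in>X. \<theta> * (\<pi>\<^sub>1 x * system_step S \<gamma> \<eta> f\<^sub>1 x y) + (1 - \<theta>) * (\<pi>\<^sub>2 x * system_step S \<gamma> \<eta> f\<^sub>2 x y))"
        by (rule sum.cong[OF refl step])
      also have "\<dots> = \<theta> * (\<Sum>x\<in>X. \<pi>\<^sub>1 x * system_step S \<gamma> \<eta> f\<^sub>1 x y) +
          (1 - \<theta>) * (\<Sum>x\<in>X. \<pi>\<^sub>2 x * system_step S \<gamma> \<eta> f\<^sub>2 x y)"
        by (simp only: sum.distrib sum_distrib_left)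
      finally show "(\<Sum>x\<in>X. \<pi> x * system_step S \<gamma> \<eta> f x y) = \<pi> y"
        unfolding stationary_balance[OF \<pi>(1) \<open>y \<in> X\<close>] stationary_balance[OF \<pi>(2) \<open>y \<in> X\<close>] \<pi>_def .
    qed (rule \<pi>_nonneg)
    show "\<exists>\<kappa>. 0 \<le> \<kappa> \<and> \<kappa> \<le> 1 \<and> (\<forall>s. f q a i s = \<kappa> * f\<^sub>1 q a i s + (1 - \<kappa>) * f\<^sub>2 q a i s)"
      if "(q, a, i) \<in> X" for q a i
      using \<kappa>_bounds[OF that] by (intro exI[of _ "\<kappa> (q, a, i)"]) (simp add: f_def)
    show "mean_queue \<pi> = \<theta> * mean_queue \<pi>\<^sub>1 + (1 - \<theta>) * mean_queue \<pi>\<^sub>2"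
      unfolding mean_queue_def sum_distrib_left sum.distrib[symmetric] \<pi>_def
      by (intro sum.cong) (auto simp: algebra_simps)
    have "p i s * \<pi> (q, a, i) * f q a i s =
        \<theta> * (p i s * \<pi>\<^sub>1 (q, a, i) * f\<^sub>1 q a i s) + (1 - \<theta>) * (p i s * \<pi>\<^sub>2 (q, a, i) * f\<^sub>2 q a i s)"
      if "(q, a, i) \<in> X" for q a i s
      unfolding mult.assoc f_eq[OF that] by (simp add: algebra_simps)
    then show "mean_power f \<pi> = \<theta> * mean_power f\<^sub>1 \<pi>\<^sub>1 + (1 - \<theta>) * mean_power f\<^sub>2 \<pi>\<^sub>2"
      unfolding mean_power_def sum_distrib_left sum.distrib[symmetric]
      by (intro sum.cong) (auto simp: sum_distrib_left sum.distrib[symmetric])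
  qed
qed

end

section \<open>From monotone rates to thresholds\<close>

context queue_mdp
begin

definition monotone_rates :: "(nat \<Rightarrow> nat \<Rightarrow> nat \<Rightarrow> nat) \<Rightarrow> bool" where
  "monotone_rates \<sigma> \<longleftrightarrow> (\<forall>(q, a, i)\<in>X. \<sigma> q a i \<in> rates q) \<and>
     (\<forall>a\<le>A. \<forall>i\<in>{1..L}. mono_on {..Q} (\<lambda>q. \<sigma> q a i))"

lemma monotone_rates_policy: "monotone_rates \<sigma> \<Longrightarrow> policy (deterministic \<sigma>)"
  by (rule deterministic_policy) (auto simp: monotone_rates_def)

lemma monotone_ratesD:
  assumes "monotone_rates \<sigma>"
  shows "(q, a, i) \<in> X \<Longrightarrow> \<sigma> q a i \<in> rates q"
    and "a \<le> A \<Longrightarrow> i \<in> {1..L} \<Longrightarrow> q \<le> q' \<Longrightarrow> q' \<le> Q \<Longrightarrow> \<sigma> q a i \<le> \<sigma> q' a i"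
  using assms by (auto simp: monotone_rates_def monotone_on_def)

text \<open>The strict inequality above \<open>q\<^sub>0\<close> makes it the last queue length
  served at its rate, hence a threshold. Only in this cell may f deviate from \<sigma>, by mixing in
  the next higher rate.\<close>

definition single_cell ::
  "policy \<Rightarrow> (nat \<Rightarrow> nat \<Rightarrow> nat \<Rightarrow> nat) \<Rightarrow> nat \<Rightarrow> nat \<Rightarrow> nat \<Rightarrow> bool" where
  "single_cell f \<sigma> q\<^sub>0 a\<^sub>0 i\<^sub>0 \<longleftrightarrow> monotone_rates \<sigma> \<and> (q\<^sub>0, a\<^sub>0, i\<^sub>0) \<in> X \<and>
     (\<forall>q\<le>Q. q\<^sub>0 < q \<longrightarrow> \<sigma> q\<^sub>0 a\<^sub>0 i\<^sub>0 < \<sigma> q a\<^sub>0 i\<^sub>0) \<and>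
     (\<forall>q a i s. (q, a, i) \<in> X \<longrightarrow> (q, a, i) \<noteq> (q\<^sub>0, a\<^sub>0, i\<^sub>0) \<longrightarrow> f q a i s = deterministic \<sigma> q a i s) \<and>
     (\<forall>s. s \<noteq> \<sigma> q\<^sub>0 a\<^sub>0 i\<^sub>0 \<longrightarrow> s \<noteq> Suc (\<sigma> q\<^sub>0 a\<^sub>0 i\<^sub>0) \<longrightarrow> f q\<^sub>0 a\<^sub>0 i\<^sub>0 s = 0) \<and>
     f q\<^sub>0 a\<^sub>0 i\<^sub>0 (\<sigma> q\<^sub>0 a\<^sub>0 i\<^sub>0) + f q\<^sub>0 a\<^sub>0 i\<^sub>0 (Suc (\<sigma> q\<^sub>0 a\<^sub>0 i\<^sub>0)) = 1"

text \<open>The randomised cell of a deterministic policy is a dummy at \<open>q = Q\<close>, where nothing lies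
  above it.\<close>

lemma single_cell_deterministic:
  "monotone_rates \<sigma> \<Longrightarrow> single_cell (deterministic \<sigma>) \<sigma> Q 0 1"
  using L_pos by (auto simp: single_cell_def deterministic_def mem_X)

text \<open>The threshold for \<open>s\<close> is the largest \<open>q\<close> with \<open>\<sigma> q a i \<le> s\<close>; counting such \<open>q\<close> gives the
  conventional value \<open>-1\<close> for \<open>s = -1\<close>.\<close>

lemma single_cell_threshold_form:
  assumes f: "single_cell f \<sigma> q\<^sub>0 a\<^sub>0 i\<^sub>0"
  shows "\<exists>thr. valid_thresholds A S Q L thr \<and>
    (\<exists>s\<^sub>0\<le>S. \<exists>a\<^sub>0\<le>A. \<exists>i\<^sub>0\<in>{1..L}. threshold_form A S Q L thr s\<^sub>0 a\<^sub>0 i\<^sub>0 f)"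
proof -
  have \<sigma>: "monotone_rates \<sigma>" and x0: "(q\<^sub>0, a\<^sub>0, i\<^sub>0) \<in> X"
    and above: "\<And>q. q \<le> Q \<Longrightarrow> q\<^sub>0 < q \<Longrightarrow> \<sigma> q\<^sub>0 a\<^sub>0 i\<^sub>0 < \<sigma> q a\<^sub>0 i\<^sub>0"
    and det: "\<And>q a i s. (q, a, i) \<in> X \<Longrightarrow> (q, a, i) \<noteq> (q\<^sub>0, a\<^sub>0, i\<^sub>0) \<Longrightarrow> f q a i s = deterministic \<sigma> q a i s"
    and zero: "\<And>s. s \<noteq> \<sigma> q\<^sub>0 a\<^sub>0 i\<^sub>0 \<Longrightarrow> s \<noteq> Suc (\<sigma> q\<^sub>0 a\<^sub>0 i\<^sub>0) \<Longrightarrow> f q\<^sub>0 a\<^sub>0 i\<^sub>0 s = 0"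
    and one: "f q\<^sub>0 a\<^sub>0 i\<^sub>0 (\<sigma> q\<^sub>0 a\<^sub>0 i\<^sub>0) + f q\<^sub>0 a\<^sub>0 i\<^sub>0 (Suc (\<sigma> q\<^sub>0 a\<^sub>0 i\<^sub>0)) = 1"
    using f unfolding single_cell_def by auto
  define B where "B t a i = {q\<in>{..Q}. int (\<sigma> q a i) \<le> t}" for t a i
  define thr where "thr t a i = int (card (B t a i)) - 1" for t a i
  \<comment> \<open>By monotonicity of the rates the counted set is an initial segment, so its
    cardinality minus 1 is its largest element, or -1 if it is empty.\<close>
  have le_thr: "int q \<le> thr t a i \<longleftrightarrow> int (\<sigma> q a i) \<le> t" if x: "(q, a, i) \<in> X" for q a i t
  proof
    assume "int (\<sigma> q a i) \<le> t"
    then have "{..q} \<subseteq> B t a i"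
      using monotone_ratesD(2)[OF \<sigma>, of a i _ q] x by (fastforce simp: B_def mem_X)
    then have "card {..q} \<le> card (B t a i)" by (rule card_mono[rotated]) (simp add: B_def)
    then show "int q \<le> thr t a i" by (simp add: thr_def)
  next
    assume le: "int q \<le> thr t a i"
    show "int (\<sigma> q a i) \<le> t"
    proof (rule ccontr)
      assume "\<not> int (\<sigma> q a i) \<le> t"
      then have "B t a i \<subseteq> {..<q}"
        using monotone_ratesD(2)[OF \<sigma>, of a i q] x by (fastforce simp: B_def mem_X not_le[symmetric])
      then have "card (B t a i) \<le> card {..<q}" by (rule card_mono[rotated]) simp
      then show False using le by (simp add: thr_def)
    qed
  qed
  have between: "thr (int s - 1) a i < int q \<and> int q \<le> thr (int s) a i \<longleftrightarrow> \<sigma> q a i = s"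
    if "(q, a, i) \<in> X" for q a i s
    using le_thr[OF that, of "int s - 1"] le_thr[OF that, of "int s"] by auto
  have thr_le_Q: "thr t a i \<le> int Q" for t a i
  proof -
    have "card (B t a i) \<le> card {..Q}" by (rule card_mono) (auto simp: B_def)
    then show ?thesis by (simp add: thr_def)
  qed
  have valid: "valid_thresholds A S Q L thr"
    unfolding valid_thresholds_def
  proof (intro allI impI ballI conjI)
    fix a i assume ai: "a \<le> A" "i \<in> {1..L}"
    show "thr (- 1) a i = - 1" by (simp add: thr_def B_def)
    have "\<sigma> 0 a i = 0" using monotone_ratesD(1)[OF \<sigma>, of 0 a i] ai by (simp add: mem_X mem_rates)
    then show "0 \<le> thr 0 a i" using le_thr[of 0 a i 0] ai by (simp add: mem_X)
    show "thr (int s) a i \<le> thr (int s + 1) a i" for s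
    proof -
      have "card (B (int s) a i) \<le> card (B (int s + 1) a i)"
        by (rule card_mono) (auto simp: B_def)
      then show ?thesis by (simp add: thr_def)
    qed
    show "thr (int S) a i \<le> int Q" by (rule thr_le_Q)
  qed
  define s\<^sub>0 where "s\<^sub>0 = \<sigma> q\<^sub>0 a\<^sub>0 i\<^sub>0"
  \<comment> \<open>The strict inequality above \<open>q\<^sub>0\<close> places the threshold
    exactly at the randomised cell.\<close>
  have thr_s0: "thr (int s\<^sub>0) a\<^sub>0 i\<^sub>0 = int q\<^sub>0"
  proof (rule antisym)
    show "int q\<^sub>0 \<le> thr (int s\<^sub>0) a\<^sub>0 i\<^sub>0" using le_thr[OF x0] by (simp add: s\<^sub>0_def)
    show "thr (int s\<^sub>0) a\<^sub>0 i\<^sub>0 \<le> int q\<^sub>0"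
    proof (rule ccontr)
      assume c: "\<not> ?thesis"
      then have "Suc q\<^sub>0 \<le> Q" using thr_le_Q[of "int s\<^sub>0" a\<^sub>0 i\<^sub>0] by linarith
      then have "(Suc q\<^sub>0, a\<^sub>0, i\<^sub>0) \<in> X" "s\<^sub>0 < \<sigma> (Suc q\<^sub>0) a\<^sub>0 i\<^sub>0"
        using x0 above by (auto simp: mem_X s\<^sub>0_def)
      then show False using le_thr[of "Suc q\<^sub>0" a\<^sub>0 i\<^sub>0 "int s\<^sub>0"] c by simp
    qed
  qed
  have "threshold_form A S Q L thr s\<^sub>0 a\<^sub>0 i\<^sub>0 f"
    unfolding threshold_form_def Let_def
  proof (intro allI impI ballI)
    fix q a i s assume "q \<le> Q" "a \<le> A" "i \<in> {1..L}" "s \<le> S"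
    then have x: "(q, a, i) \<in> X" by (simp add: mem_X)
    let ?lo = "thr (int s - 1) a i" and ?hi = "thr (int s) a i" and ?star = "a = a\<^sub>0 \<and> s = s\<^sub>0 \<and> i = i\<^sub>0"
    let ?goal = "(?lo < int q \<and> int q \<le> ?hi \<and> \<not> ?star \<longrightarrow> f q a i s = 1) \<and>
      (?lo < int q \<and> int q < ?hi \<and> ?star \<longrightarrow> f q a i s = 1) \<and>
      (int q = ?hi \<and> ?star \<longrightarrow> f q a i s + f q a i (s + 1) = 1) \<and>
      (\<not> (?lo < int q \<and> int q \<le> ?hi \<and> \<not> ?star) \<and> \<not> (?lo < int q \<and> int q < ?hi \<and> ?star) \<and>
       \<not> (int q = ?hi \<and> ?star) \<and>
       \<not> (int q = thr (int s\<^sub>0) a\<^sub>0 i\<^sub>0 \<and> a = a\<^sub>0 \<and> s = s\<^sub>0 + 1 \<and> i = i\<^sub>0) \<longrightarrow> f q a i s = 0)"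
    show ?goal
    \<comment> \<open>In the cell itself the mixed clause handles \<open>s\<^sub>0\<close>, and the
      exemption covers \<open>s\<^sub>0 + 1\<close>. Elsewhere the mixed clause cannot apply, as the
      threshold of \<open>s\<^sub>0\<close> is \<open>q\<^sub>0\<close>.\<close>
    proof (cases "(q, a, i) = (q\<^sub>0, a\<^sub>0, i\<^sub>0)")
      case True
      then show ?thesis
        using between[OF x, of s] one zero[of s] thr_s0 by (auto simp: s\<^sub>0_def)
    next
      case False
      then have "f q a i s = (if \<sigma> q a i = s then 1 else 0)"
        using det[OF x] by (auto simp: deterministic_def)
      moreover have "\<not> (int q = ?hi \<and> ?star)" using False thr_s0 by auto
      ultimately show ?thesis using between[OF x, of s] by auto
    qed
  qed
  moreover have "s\<^sub>0 \<le> S"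
    using monotone_ratesD(1)[OF \<sigma> x0] by (simp add: s\<^sub>0_def mem_rates)
  ultimately show ?thesis using valid x0 unfolding mem_X by blast
qed

text \<open>The mixture has weights that depend on the state, but where both policies agree the
  weight is invisible, so only one cell is randomised. Equality of the rates in that cell is allowed
  too, since one policy may have two stationary distributions to be mixed.\<close>

lemma single_cell_mixture:
  assumes \<sigma>: "monotone_rates \<sigma>" "monotone_rates \<sigma>'" and x0: "(q\<^sub>0, a\<^sub>0, i\<^sub>0) \<in> X"
    and agree: "\<And>q a i. (q, a, i) \<in> X \<Longrightarrow> (q, a, i) \<noteq> (q\<^sub>0, a\<^sub>0, i\<^sub>0) \<Longrightarrow> \<sigma>' q a i = \<sigma> q a i"
    and cell: "\<sigma>' q\<^sub>0 a\<^sub>0 i\<^sub>0 = \<sigma> q\<^sub>0 a\<^sub>0 i\<^sub>0 \<or> \<sigma>' q\<^sub>0 a\<^sub>0 i\<^sub>0 = Suc (\<sigma> q\<^sub>0 a\<^sub>0 i\<^sub>0)"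
    and above: "\<And>q. q \<le> Q \<Longrightarrow> q\<^sub>0 < q \<Longrightarrow> \<sigma> q\<^sub>0 a\<^sub>0 i\<^sub>0 < \<sigma> q a\<^sub>0 i\<^sub>0"
    and \<pi>: "stationary (deterministic \<sigma>) \<pi>" "stationary (deterministic \<sigma>') \<pi>'"
    and d: "mean_queue \<pi>' \<le> d" "d \<le> mean_queue \<pi>"
  obtains f \<pi>'' where "policy f" "stationary f \<pi>''" "mean_queue \<pi>'' = d" "single_cell f \<sigma> q\<^sub>0 a\<^sub>0 i\<^sub>0"
    "\<And>q a i s. (q, a, i) \<in> X \<Longrightarrow> f q a i s \<noteq> 0 \<Longrightarrow> s = \<sigma> q a i \<or> s = \<sigma>' q a i"
proof -
  obtain \<theta> where \<theta>: "0 \<le> \<theta>" "\<theta> \<le> 1" "d = \<theta> * mean_queue \<pi> + (1 - \<theta>) * mean_queue \<pi>'"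
  proof -
    have "d \<in> closed_segment (mean_queue \<pi>') (mean_queue \<pi>)"
      using d by (simp add: closed_segment_eq_real_ivl)
    then show thesis using that by (auto simp: in_segment)
  qed
  obtain f \<pi>'' where f: "policy f" "stationary f \<pi>''"
    and \<kappa>: "\<And>q a i. (q, a, i) \<in> X \<Longrightarrow> \<exists>\<kappa>. 0 \<le> \<kappa> \<and> \<kappa> \<le> 1 \<and>
      (\<forall>s. f q a i s = \<kappa> * deterministic \<sigma> q a i s + (1 - \<kappa>) * deterministic \<sigma>' q a i s)"
    and mean: "mean_queue \<pi>'' = \<theta> * mean_queue \<pi> + (1 - \<theta>) * mean_queue \<pi>'"
    using mixture[OF monotone_rates_policy[OF \<sigma>(1)] monotone_rates_policy[OF \<sigma>(2)] \<pi> \<theta>(1,2)] by metis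
  have det: "f q a i s = deterministic \<sigma> q a i s"
    if "(q, a, i) \<in> X" "(q, a, i) \<noteq> (q\<^sub>0, a\<^sub>0, i\<^sub>0)" for q a i s
  proof -
    note x = that(1)
    obtain k where "\<forall>s. f q a i s = k * deterministic \<sigma> q a i s + (1 - k) * deterministic \<sigma>' q a i s"
      using \<kappa>[OF x] by blast
    then show ?thesis using agree[OF that] by (simp add: deterministic_def)
  qed
  have "single_cell f \<sigma> q\<^sub>0 a\<^sub>0 i\<^sub>0"
    unfolding single_cell_def
  proof (intro conjI allI impI)
    obtain k where k: "\<forall>s. f q\<^sub>0 a\<^sub>0 i\<^sub>0 s =
        k * deterministic \<sigma> q\<^sub>0 a\<^sub>0 i\<^sub>0 s + (1 - k) * deterministic \<sigma>' q\<^sub>0 a\<^sub>0 i\<^sub>0 s"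
      using \<kappa>[OF x0] by blast
    show "f q\<^sub>0 a\<^sub>0 i\<^sub>0 s = 0" if "s \<noteq> \<sigma> q\<^sub>0 a\<^sub>0 i\<^sub>0" "s \<noteq> Suc (\<sigma> q\<^sub>0 a\<^sub>0 i\<^sub>0)" for s
      using k cell that by (auto simp: deterministic_def)
    show "f q\<^sub>0 a\<^sub>0 i\<^sub>0 (\<sigma> q\<^sub>0 a\<^sub>0 i\<^sub>0) + f q\<^sub>0 a\<^sub>0 i\<^sub>0 (Suc (\<sigma> q\<^sub>0 a\<^sub>0 i\<^sub>0)) = 1"
      using k cell by (auto simp: deterministic_def)
  qed (use \<sigma> x0 above det in auto)
  moreover have "s = \<sigma> q a i \<or> s = \<sigma>' q a i" if "(q, a, i) \<in> X" "f q a i s \<noteq> 0" for q a i s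
    using \<kappa>[OF that(1)] that(2) by (auto simp: deterministic_def split: if_splits)
  ultimately show thesis using that f mean \<theta>(3) by simp
qed

text \<open>Raise \<open>\<sigma>\<close> towards \<open>\<tau>\<close> by one packet at a time, always at the largest possible queue length,
  until the mean queue length drops below \<open>d\<close>; then mix the last two policies.\<close>

lemma monotone_walk:
  assumes \<tau>: "monotone_rates \<tau>" "stationary (deterministic \<tau>) \<pi>'" "mean_queue \<pi>' \<le> d"
    and \<sigma>: "monotone_rates \<sigma>" "stationary (deterministic \<sigma>) \<pi>" "d \<le> mean_queue \<pi>"
    and le: "\<And>q a i. (q, a, i) \<in> X \<Longrightarrow> \<sigma> q a i \<le> \<tau> q a i"
    and strip: "\<And>q a i s. (q, a, i) \<in> X \<Longrightarrow> \<sigma> q a i \<le> s \<Longrightarrow> s \<le> \<tau> q a i \<Longrightarrow> s \<in> rates q"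
  shows "\<exists>f \<pi> \<sigma>' q\<^sub>0 a\<^sub>0 i\<^sub>0. policy f \<and> stationary f \<pi> \<and> mean_queue \<pi> = d \<and> single_cell f \<sigma>' q\<^sub>0 a\<^sub>0 i\<^sub>0 \<and>
    (\<forall>q a i s. (q, a, i) \<in> X \<longrightarrow> f q a i s \<noteq> 0 \<longrightarrow> \<sigma> q a i \<le> s \<and> s \<le> \<tau> q a i)"
  using \<sigma> le strip
proof (induction "\<Sum>(q, a, i)\<in>X. \<tau> q a i - \<sigma> q a i" arbitrary: \<sigma> \<pi> rule: less_induct)
  case less
  note le = less.prems(4)
  show ?case
  proof (cases "\<forall>(q, a, i)\<in>X. \<sigma> q a i = \<tau> q a i")
    case True
    \<comment> \<open>The walk has arrived at \<tau>, but \<pi> and \<pi>' may still be different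
      stationary distributions of the same policy. They are mixed, with a dummy cell at the top of
      the buffer.\<close>
    then have eq: "\<tau> q a i = \<sigma> q a i" if "(q, a, i) \<in> X" for q a i using that by auto
    obtain f \<pi>'' where f: "policy f" "stationary f \<pi>''" "mean_queue \<pi>'' = d" "single_cell f \<sigma> Q 0 1"
      and supp: "\<And>q a i s. (q, a, i) \<in> X \<Longrightarrow> f q a i s \<noteq> 0 \<Longrightarrow> s = \<sigma> q a i \<or> s = \<tau> q a i"
      using eq L_pos
      by (elim single_cell_mixture[OF less.prems(1) \<tau>(1) _ _ _ _ less.prems(2) \<tau>(2,3) less.prems(3), rotated -1])
        (auto simp: mem_X)
    have "\<sigma> q a i \<le> s \<and> s \<le> \<tau> q a i" if "(q, a, i) \<in> X" "f q a i s \<noteq> 0" for q a i s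
      using supp[OF that] eq[OF that(1)] by auto
    then show ?thesis using f by blast
  next
    case False
    then obtain q\<^sub>1 a i where x1: "(q\<^sub>1, a, i) \<in> X" "\<sigma> q\<^sub>1 a i \<noteq> \<tau> q\<^sub>1 a i" by auto
    then have ai: "a \<le> A" "i \<in> {1..L}" and ex: "\<exists>q\<le>Q. \<sigma> q a i \<noteq> \<tau> q a i"
      unfolding mem_X by blast+
    define q where "q = Max {q\<in>{..Q}. \<sigma> q a i \<noteq> \<tau> q a i}"
    have "q \<in> {q\<in>{..Q}. \<sigma> q a i \<noteq> \<tau> q a i}" unfolding q_def using ex by (intro Max_in) auto
    then have q: "q \<le> Q" "\<sigma> q a i \<noteq> \<tau> q a i" by auto
    have above: "\<sigma> q' a i = \<tau> q' a i" if "q' \<le> Q" "q < q'" for q'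
    proof (rule ccontr)
      assume "\<not> ?thesis"
      then have "q' \<le> q" unfolding q_def using that by (intro Max_ge) auto
      then show False using that by simp
    qed
    have x: "(q, a, i) \<in> X" using q ai by (simp add: mem_X)
    have lt: "\<sigma> q a i < \<tau> q a i" using le[OF x] q by simp
    define \<sigma>' where "\<sigma>' q' a' i' = (if (q', a', i') = (q, a, i) then Suc (\<sigma> q a i) else \<sigma> q' a' i')" for q' a' i'
    have \<sigma>'_le: "\<sigma>' q' a' i' \<le> \<tau> q' a' i'" if "(q', a', i') \<in> X" for q' a' i'
      using le[OF that] lt by (auto simp: \<sigma>'_def)
    have le_\<sigma>': "\<sigma> q' a' i' \<le> \<sigma>' q' a' i'" for q' a' i' by (simp add: \<sigma>'_def)
    \<comment> \<open>Above q both policies agree, so the rate there already exceeds that at q. Thus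
      raising it by one preserves monotonicity, and q is the last queue length at its old rate, as
      the randomised cell requires.\<close>
    have jump: "\<sigma> q a i < \<sigma> q' a i" if "q' \<le> Q" "q < q'" for q'
      using lt monotone_ratesD(2)[OF \<tau>(1) ai, of q q'] above[OF that] that by simp
    have \<sigma>': "monotone_rates \<sigma>'"
      unfolding monotone_rates_def
    proof (intro conjI ballI allI impI mono_onI)
      fix y assume "y \<in> X"
      then show "case y of (q', a', i') \<Rightarrow> \<sigma>' q' a' i' \<in> rates q'"
        using less.prems(5) le_\<sigma>' \<sigma>'_le by (cases y) auto
    next
      fix a' i' r t assume *: "a' \<le> A" "i' \<in> {1..L}" "r \<in> {..Q}" "t \<in> {..Q}" "r \<le> t"
      have "\<sigma> r a' i' \<le> \<sigma> t a' i'" using * by (intro monotone_ratesD(2)[OF less.prems(1)]) auto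
      then show "\<sigma>' r a' i' \<le> \<sigma>' t a' i'" using jump[of t] * by (fastforce simp: \<sigma>'_def)
    qed
    \<comment> \<open>Any stationary distribution of the raised policy serves: if its mean is still
      at least d, the walk continues from it; otherwise d lies between the last two means.\<close>
    obtain \<pi>\<^sub>1 where \<pi>1: "stationary (deterministic \<sigma>') \<pi>\<^sub>1"
      using stationary_exists[OF monotone_rates_policy[OF \<sigma>']] .
    show ?thesis
    proof (cases "d \<le> mean_queue \<pi>\<^sub>1")
      case True
      have "(\<Sum>(q, a, i)\<in>X. \<tau> q a i - \<sigma>' q a i) < (\<Sum>(q, a, i)\<in>X. \<tau> q a i - \<sigma> q a i)"
      proof (rule sum_strict_mono_ex1)
        show "\<forall>y\<in>X. (case y of (q, a, i) \<Rightarrow> \<tau> q a i - \<sigma>' q a i) \<le> (case y of (q, a, i) \<Rightarrow> \<tau> q a i - \<sigma> q a i)"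
          using le_\<sigma>' by (auto intro!: diff_le_mono2)
        show "\<exists>y\<in>X. (case y of (q, a, i) \<Rightarrow> \<tau> q a i - \<sigma>' q a i) < (case y of (q, a, i) \<Rightarrow> \<tau> q a i - \<sigma> q a i)"
          using x lt by (intro bexI[OF _ x]) (simp add: \<sigma>'_def)
      qed simp
      then have "\<exists>f \<pi> \<sigma>'' q\<^sub>0 a\<^sub>0 i\<^sub>0. policy f \<and> stationary f \<pi> \<and> mean_queue \<pi> = d \<and>
          single_cell f \<sigma>'' q\<^sub>0 a\<^sub>0 i\<^sub>0 \<and>
          (\<forall>q a i s. (q, a, i) \<in> X \<longrightarrow> f q a i s \<noteq> 0 \<longrightarrow> \<sigma>' q a i \<le> s \<and> s \<le> \<tau> q a i)"
      proof (rule less.hyps[OF _ \<sigma>' \<pi>1 True \<sigma>'_le])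
        fix q a i s assume "(q, a, i) \<in> X" "\<sigma>' q a i \<le> s" "s \<le> \<tau> q a i"
        then show "s \<in> rates q" using less.prems(5) le_\<sigma>'[of q a i] by simp
      qed
      then obtain f \<pi>'' \<sigma>'' q\<^sub>0 a\<^sub>0 i\<^sub>0 where f: "policy f" "stationary f \<pi>''" "mean_queue \<pi>'' = d"
          "single_cell f \<sigma>'' q\<^sub>0 a\<^sub>0 i\<^sub>0"
        and supp: "\<And>q a i s. (q, a, i) \<in> X \<Longrightarrow> f q a i s \<noteq> 0 \<Longrightarrow> \<sigma>' q a i \<le> s \<and> s \<le> \<tau> q a i"
        by blast
      have "\<sigma> q a i \<le> s \<and> s \<le> \<tau> q a i" if "(q, a, i) \<in> X" "f q a i s \<noteq> 0" for q a i s
        using supp[OF that] le_\<sigma>'[of q a i] by simp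
      then show ?thesis using f by blast
    next
      case False
      obtain f \<pi>'' where f: "policy f" "stationary f \<pi>''" "mean_queue \<pi>'' = d" "single_cell f \<sigma> q a i"
        and supp: "\<And>q a i s. (q, a, i) \<in> X \<Longrightarrow> f q a i s \<noteq> 0 \<Longrightarrow> s = \<sigma> q a i \<or> s = \<sigma>' q a i"
      proof (rule single_cell_mixture[OF less.prems(1) \<sigma>' x _ _ _ less.prems(2) \<pi>1 _ less.prems(3)])
        show "mean_queue \<pi>\<^sub>1 \<le> d" using False by simp
      qed (use jump that in \<open>auto simp: \<sigma>'_def\<close>)
      have "\<sigma> q a i \<le> s \<and> s \<le> \<tau> q a i" if "(q, a, i) \<in> X" "f q a i s \<noteq> 0" for q a i s
        using supp[OF that] le[OF that(1)] le_\<sigma>' \<sigma>'_le[OF that(1)] by auto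
      then show ?thesis using f by blast
    qed
  qed
qed

end

section \<open>Optimal policies\<close>

context queue_mdp
begin

definition mean_cost :: "policy \<Rightarrow> (nat \<times> nat \<times> nat \<Rightarrow> real) \<Rightarrow> real" where
  "mean_cost f \<pi> = mean_power f \<pi> + w * mean_queue \<pi>"

text \<open>The excess of a rate over the minimum in the optimality equation, i.e. the negated
  advantage function.\<close>

definition regret :: "(nat \<times> nat \<times> nat \<Rightarrow> real) \<Rightarrow> nat \<Rightarrow> nat \<Rightarrow> nat \<Rightarrow> nat \<Rightarrow> real" where
  "regret u q a i s = p i s + next_val u a (q - s) - infconv (p i) (next_val u a) q"

definition mean_regret ::
  "(nat \<times> nat \<times> nat \<Rightarrow> real) \<Rightarrow> policy \<Rightarrow> (nat \<times> nat \<times> nat \<Rightarrow> real) \<Rightarrow> real" where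
  "mean_regret u f \<pi> = (\<Sum>(q, a, i)\<in>X. \<Sum>s\<le>S. \<pi> (q, a, i) * f q a i s * regret u q a i s)"

lemma regret_nonneg: "s \<in> rates q \<Longrightarrow> 0 \<le> regret u q a i s"
  using infconv_le by (simp add: regret_def)

lemma regret_eq_0: "s \<in> rates q \<Longrightarrow> regret u q a i s = 0 \<longleftrightarrow> s \<in> best (p i) (next_val u a) q"
  by (auto simp: regret_def best_def)

text \<open>This is the performance difference formula: when the optimality equation is integrated
  against \<pi> f, stationarity cancels the terms in u.\<close>

lemma mean_cost_eq:
  assumes f: "policy f" and \<pi>: "stationary f \<pi>"
    and u: "\<And>x. x \<in> X \<Longrightarrow> g + u x = bellman 1 u x"
  shows "mean_cost f \<pi> = g + mean_regret u f \<pi>"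
proof -
  have cell: "(\<Sum>s\<le>S. \<pi> (q, a, i) * f q a i s * regret u q a i s) =
      (\<Sum>s\<le>S. p i s * \<pi> (q, a, i) * f q a i s) + w * (real q * \<pi> (q, a, i)) +
      \<pi> (q, a, i) * (\<Sum>s\<le>S. f q a i s * next_val u a (q - s)) - \<pi> (q, a, i) * u (q, a, i) - g * \<pi> (q, a, i)"
    if x: "(q, a, i) \<in> X" for q a i
  proof -
    have "(\<Sum>s\<le>S. \<pi> (q, a, i) * f q a i s * regret u q a i s) =
        (\<Sum>s\<le>S. p i s * \<pi> (q, a, i) * f q a i s) + \<pi> (q, a, i) * (\<Sum>s\<le>S. f q a i s * next_val u a (q - s))
        - \<pi> (q, a, i) * infconv (p i) (next_val u a) q * (\<Sum>s\<le>S. f q a i s)"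
      unfolding sum_distrib_left sum.distrib[symmetric] sum_subtractf[symmetric] regret_def
      by (intro sum.cong) (auto simp: algebra_simps)
    also have "infconv (p i) (next_val u a) q = g + u (q, a, i) - w * real q"
      using u[OF x] by (simp add: bellman_def)
    finally show ?thesis using policy_sum[OF f x] by (simp add: algebra_simps)
  qed
  have "(\<Sum>(q, a, i)\<in>X. \<Sum>s\<le>S. \<pi> (q, a, i) * f q a i s * regret u q a i s) =
      (\<Sum>x\<in>X. (case x of (q, a, i) \<Rightarrow> \<Sum>s\<le>S. p i s * \<pi> (q, a, i) * f q a i s) +
        w * (case x of (q, a, i) \<Rightarrow> real q * \<pi> (q, a, i)) +
        (case x of (q, a, i) \<Rightarrow> \<pi> (q, a, i) * (\<Sum>s\<le>S. f q a i s * next_val u a (q - s))) -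
        \<pi> x * u x - g * \<pi> x)"
    by (rule sum.cong) (auto simp: cell)
  also have "\<dots> = mean_power f \<pi> + w * mean_queue \<pi> +
      (\<Sum>(q, a, i)\<in>X. \<pi> (q, a, i) * (\<Sum>s\<le>S. f q a i s * next_val u a (q - s))) -
      (\<Sum>x\<in>X. \<pi> x * u x) - g * (\<Sum>x\<in>X. \<pi> x)"
    by (simp only: mean_power_def mean_queue_def sum.distrib sum_subtractf sum_distrib_left)
  also have "\<dots> = mean_cost f \<pi> - g"
    using stationary_expectation[OF f \<pi>, of u] stationary_sum[OF \<pi>] by (simp add: mean_cost_def)
  finally show ?thesis by (simp add: mean_regret_def)
qed

definition optimal :: "policy \<Rightarrow> (nat \<times> nat \<times> nat \<Rightarrow> real) \<Rightarrow> bool" where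
  "optimal f \<pi> \<longleftrightarrow> policy f \<and> stationary f \<pi> \<and>
     (\<forall>f' \<pi>'. policy f' \<longrightarrow> stationary f' \<pi>' \<longrightarrow> mean_cost f \<pi> \<le> mean_cost f' \<pi>')"

lemma
  assumes u: "convex_val u"
  shows lowest_monotone_rates: "monotone_rates (\<lambda>q a i. lowest (p i) (next_val u a) q)"
    and highest_monotone_rates: "monotone_rates (\<lambda>q a i. highest (p i) (next_val u a) q)"
    and lowest_rest_mono: "a \<le> A \<Longrightarrow> i \<in> {1..L} \<Longrightarrow> mono_on {..Q} (\<lambda>q. q - lowest (p i) (next_val u a) q)"
    and highest_rest_mono: "a \<le> A \<Longrightarrow> i \<in> {1..L} \<Longrightarrow> mono_on {..Q} (\<lambda>q. q - highest (p i) (next_val u a) q)"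
proof -
  have in_rates: "lowest f G q \<in> rates q" "highest f G q \<in> rates q" if "q \<le> Q" for f G q
    using lowest_in[OF that] highest_in[OF that] best_subset by blast+
  note Suc = lowest_Suc[OF p_convex next_val_convex[OF u]] highest_Suc[OF p_convex next_val_convex[OF u]]
  show "monotone_rates (\<lambda>q a i. lowest (p i) (next_val u a) q)"
    "monotone_rates (\<lambda>q a i. highest (p i) (next_val u a) q)"
    unfolding monotone_rates_def
    by (auto simp: mem_X in_rates intro!: mono_on_atMost_SucI Suc)
  show "mono_on {..Q} (\<lambda>q. q - lowest (p i) (next_val u a) q)" if "a \<le> A" "i \<in> {1..L}"
  proof (rule mono_on_atMost_SucI)
    fix q assume "q < Q"
    from Suc(2)[OF that(2,1) this] show "q - lowest (p i) (next_val u a) q \<le> Suc q - lowest (p i) (next_val u a) (Suc q)"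
      by simp
  qed
  show "mono_on {..Q} (\<lambda>q. q - highest (p i) (next_val u a) q)" if "a \<le> A" "i \<in> {1..L}"
  proof (rule mono_on_atMost_SucI)
    fix q assume "q < Q"
    from Suc(4)[OF that(2,1) this] show "q - highest (p i) (next_val u a) q \<le> Suc q - highest (p i) (next_val u a) (Suc q)"
      by simp
  qed
qed

text \<open>Regret is nonnegative and the policy of lowest best rates has none, so the optimal cost
  is g. An optimal policy then has mean regret 0, which forces every term, and so every rate used
  with positive mass, to be free of regret.\<close>

lemma optimal_support:
  assumes opt: "optimal f \<pi>"
    and u: "\<And>x. x \<in> X \<Longrightarrow> g + u x = bellman 1 u x" and convex: "convex_val u"
  shows optimal_value: "mean_cost f \<pi> = g"
    and optimal_best: "(q, a, i) \<in> X \<Longrightarrow> 0 < \<pi> (q, a, i) \<Longrightarrow> 0 < f q a i s \<Longrightarrow>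
      s \<in> best (p i) (next_val u a) q"
proof -
  have f: "policy f" and \<pi>: "stationary f \<pi>" using opt by (simp_all add: optimal_def)
  have nonneg: "0 \<le> \<pi> (q, a, i) * f q a i s * regret u q a i s"
    if "(q, a, i) \<in> X" "s \<le> S" for q a i s
    using stationary_nonneg[OF \<pi> that(1)] policy_nonneg[OF f that]
      policy_rates[OF f that(1), of s] regret_nonneg[of s q u a i]
    by (cases "f q a i s = 0") auto
  have "0 \<le> mean_regret u f \<pi>"
    unfolding mean_regret_def using nonneg by (auto intro!: sum_nonneg)
  then have "g \<le> mean_cost f \<pi>" using mean_cost_eq[OF f \<pi> u] by simp
  moreover have "mean_cost f \<pi> \<le> g"
  proof -
    define \<sigma> where "\<sigma> q a i = lowest (p i) (next_val u a) q" for q a i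
    have \<sigma>: "policy (deterministic \<sigma>)"
      unfolding \<sigma>_def by (intro monotone_rates_policy lowest_monotone_rates convex)
    obtain \<pi>' where \<pi>': "stationary (deterministic \<sigma>) \<pi>'" using stationary_exists[OF \<sigma>] .
    have "deterministic \<sigma> q a i s * regret u q a i s = 0" if "(q, a, i) \<in> X" for q a i s
      using lowest_in[of q "p i" "next_val u a"] that
      by (auto simp: deterministic_def \<sigma>_def mem_X best_def regret_def)
    then have "mean_regret u (deterministic \<sigma>) \<pi>' = 0"
      unfolding mean_regret_def by (auto intro!: sum.neutral simp: mult.assoc)
    then have "mean_cost (deterministic \<sigma>) \<pi>' = g" using mean_cost_eq[OF \<sigma> \<pi>' u] by simp
    then show ?thesis using opt \<sigma> \<pi>' unfolding optimal_def by metis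
  qed
  ultimately show val: "mean_cost f \<pi> = g" by simp
  show "s \<in> best (p i) (next_val u a) q"
    if x: "(q, a, i) \<in> X" and pos: "0 < \<pi> (q, a, i)" "0 < f q a i s"
  proof -
    have s: "s \<in> rates q" using policy_rates[OF f x] pos by simp
    then have sS: "s \<le> S" by (simp add: mem_rates)
    have "(\<Sum>(q, a, i)\<in>X. \<Sum>s\<le>S. \<pi> (q, a, i) * f q a i s * regret u q a i s) = 0"
      using mean_cost_eq[OF f \<pi> u] val by (simp add: mean_regret_def)
    then have "(\<Sum>s\<le>S. \<pi> (q, a, i) * f q a i s * regret u q a i s) = 0"
      using x nonneg by (subst (asm) sum_nonneg_eq_0_iff) (auto intro!: sum_nonneg)
    then have "\<pi> (q, a, i) * f q a i s * regret u q a i s = 0"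
      using x nonneg sS by (subst (asm) sum_nonneg_eq_0_iff) auto
    then show ?thesis using pos s regret_eq_0 by auto
  qed
qed

lemma optimal_single_cell:
  assumes opt: "optimal f \<pi>"
  shows "\<exists>f' \<pi>' \<sigma> q\<^sub>0 a\<^sub>0 i\<^sub>0. policy f' \<and> stationary f' \<pi>' \<and> mean_queue \<pi>' = mean_queue \<pi> \<and>
    mean_power f' \<pi>' = mean_power f \<pi> \<and> single_cell f' \<sigma> q\<^sub>0 a\<^sub>0 i\<^sub>0"
proof -
  have f: "policy f" and \<pi>: "stationary f \<pi>" using opt by (simp_all add: optimal_def)
  obtain g u where u: "\<And>x. x \<in> X \<Longrightarrow> g + u x = bellman 1 u x" and convex: "convex_val u"
    using optimality_equation by metis
  define lo hi where "lo q a i = lowest (p i) (next_val u a) q"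
    and "hi q a i = highest (p i) (next_val u a) q" for q a i
  have lo: "monotone_rates lo" and hi: "monotone_rates hi"
    unfolding lo_def hi_def using lowest_monotone_rates[OF convex] highest_monotone_rates[OF convex] .
  note best = optimal_best[OF opt u convex]
  obtain \<pi>\<^sub>1 where \<pi>1: "stationary (deterministic lo) \<pi>\<^sub>1" "mean_queue \<pi> \<le> mean_queue \<pi>\<^sub>1"
  proof (rule comparison_policy[OF f \<pi>, where \<sigma> = lo and e = 1])
    show "lo q a i \<in> rates q" if "(q, a, i) \<in> X" for q a i using monotone_ratesD(1)[OF lo that] .
  qed (use lowest_rest_mono[OF convex] best in \<open>auto simp: lo_def intro!: lowest_le\<close>)
  obtain \<pi>\<^sub>2 where \<pi>2: "stationary (deterministic hi) \<pi>\<^sub>2" "mean_queue \<pi>\<^sub>2 \<le> mean_queue \<pi>"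
  proof (rule comparison_policy[OF f \<pi>, where \<sigma> = hi and e = "- 1"])
    show "hi q a i \<in> rates q" if "(q, a, i) \<in> X" for q a i using monotone_ratesD(1)[OF hi that] .
  qed (use highest_rest_mono[OF convex] best in \<open>auto simp: hi_def intro!: le_highest\<close>)
  have strip: "s \<in> best (p i) (next_val u a) q"
    if "(q, a, i) \<in> X" "lo q a i \<le> s" "s \<le> hi q a i" for q a i s
  proof -
    have x: "q \<le> Q" "a \<le> A" "i \<in> {1..L}" using that(1) by (auto simp: mem_X)
    show ?thesis
      using best_interval[OF p_convex[OF x(3)] next_val_convex[OF convex x(2)] lowest_in[OF x(1)]
          highest_in[OF x(1)]] that(2,3)
      unfolding lo_def hi_def .
  qed
  have lo_le_hi: "lo q a i \<le> hi q a i" if "(q, a, i) \<in> X" for q a i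
    using lowest_in[of q "p i" "next_val u a"] that
    unfolding lo_def hi_def mem_X by (intro le_highest) auto
  have "\<exists>f' \<pi>' \<sigma> q\<^sub>0 a\<^sub>0 i\<^sub>0. policy f' \<and> stationary f' \<pi>' \<and> mean_queue \<pi>' = mean_queue \<pi> \<and>
      single_cell f' \<sigma> q\<^sub>0 a\<^sub>0 i\<^sub>0 \<and>
      (\<forall>q a i s. (q, a, i) \<in> X \<longrightarrow> f' q a i s \<noteq> 0 \<longrightarrow> lo q a i \<le> s \<and> s \<le> hi q a i)"
    by (rule monotone_walk[OF hi \<pi>2 lo \<pi>1]) (use lo_le_hi strip best_subset in blast)+
  then obtain f' \<pi>' \<sigma> q\<^sub>0 a\<^sub>0 i\<^sub>0 where f': "policy f'" "stationary f' \<pi>'" "mean_queue \<pi>' = mean_queue \<pi>"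
      "single_cell f' \<sigma> q\<^sub>0 a\<^sub>0 i\<^sub>0"
    and supp: "\<And>q a i s. (q, a, i) \<in> X \<Longrightarrow> f' q a i s \<noteq> 0 \<Longrightarrow> lo q a i \<le> s \<and> s \<le> hi q a i"
    by metis
  \<comment> \<open>Best rates form an interval, so a policy staying between \<open>lo\<close> and
    \<open>hi\<close> has no regret, whatever its stationary distribution.\<close>
  have "f' q a i s * regret u q a i s = 0" if "(q, a, i) \<in> X" for q a i s
    using supp[OF that, of s] strip[OF that, of s] by (auto simp: best_def regret_def)
  then have "mean_regret u f' \<pi>' = 0"
    unfolding mean_regret_def by (auto intro!: sum.neutral simp: mult.assoc)
  then have "mean_cost f' \<pi>' = g" using mean_cost_eq[OF f'(1,2) u] by simp
  then have "mean_power f' \<pi>' = mean_power f \<pi>"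
    using optimal_value[OF opt u convex] f'(3) by (simp add: mean_cost_def)
  then show ?thesis using f' by blast
qed

text \<open>If only the queue is charged, the relative value is strictly increasing in \<open>q\<close> and
  the best rate is unique.\<close>

lemma optimal_queue_deterministic:
  assumes opt: "optimal f \<pi>" and w: "0 < w" and p: "\<And>i s. p i s = 0"
  obtains \<sigma> where "monotone_rates \<sigma>"
    "\<And>q a i s. (q, a, i) \<in> X \<Longrightarrow> 0 < \<pi> (q, a, i) \<Longrightarrow> 0 < f q a i s \<Longrightarrow> s = \<sigma> q a i"
proof -
  obtain g u where u: "\<And>x. x \<in> X \<Longrightarrow> g + u x = bellman 1 u x" and shape: "monotone_val u" "convex_val u"
    using optimality_equation by metis
  \<comment> \<open>The optimality equation adds the strictly increasing w q to a term that is
    monotone.\<close>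
  have u_less: "u (q, a, i) < u (q', a, i)"
    if "q < q'" "(q, a, i) \<in> X" "(q', a, i) \<in> X" for q q' a i
  proof -
    have "infconv (p i) (\<lambda>r. 1 * next_val u a r) q \<le> infconv (p i) (\<lambda>r. 1 * next_val u a r) q'"
      using that by (intro mono_onD[OF infconv_next_monotone[OF shape(1)]]) (auto simp: mem_X)
    moreover have "w * real q < w * real q'" using w that(1) by simp
    ultimately show ?thesis
      using u[OF that(2)] u[OF that(3)] by (simp add: bellman_def)
  qed
  have next_less: "next_val u a r < next_val u a t" if "a \<le> A" "r < t" "t \<le> Q - A" for a r t
  proof (rule ccontr)
    \<comment> \<open>All differences are positive, so one successor and one channel of positive
      probability make the expectation strictly larger.\<close>
    have v_pos: "0 < u (t + a', a', i') - u (r + a', a', i')" if "a' \<le> A" "i' \<in> {1..L}" for a' i'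
      using u_less[of "r + a'" "t + a'" a' i'] that \<open>r < t\<close> \<open>t \<le> Q - A\<close> A_le_Q by (simp add: mem_X)
    have eq: "next_val u a t - next_val u a r =
        (\<Sum>a'\<le>A. \<Sum>i'=1..L. \<gamma> a a' * \<eta> i' * (u (t + a', a', i') - u (r + a', a', i')))"
      by (simp add: next_val_def sum_subtractf right_diff_distrib)
    obtain b where b: "b \<le> A" "0 < \<gamma> a b" using \<gamma>_successor[OF \<open>a \<le> A\<close>] .
    have "\<exists>j\<in>{1..L}. \<eta> j \<noteq> 0" using sum_\<eta> by (metis (no_types, lifting) sum.neutral zero_neq_one)
    then obtain j where j: "j \<in> {1..L}" "0 < \<eta> j" using \<eta>_nonneg by (metis less_eq_real_def)
    have nonneg: "0 \<le> \<gamma> a a' * \<eta> i' * (u (t + a', a', i') - u (r + a', a', i'))"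
      if "a' \<le> A" "i' \<in> {1..L}" for a' i'
      using v_pos[OF that] that \<open>a \<le> A\<close> by (intro mult_nonneg_nonneg \<gamma>_nonneg \<eta>_nonneg) auto
    have "0 < \<gamma> a b * \<eta> j * (u (t + b, b, j) - u (r + b, b, j))"
      using b j v_pos by simp
    also have "\<dots> \<le> (\<Sum>i'=1..L. \<gamma> a b * \<eta> i' * (u (t + b, b, i') - u (r + b, b, i')))"
      using j b nonneg by (intro member_le_sum) auto
    also have "\<dots> \<le> next_val u a t - next_val u a r"
      unfolding eq using b nonneg
      by (intro member_le_sum[of b "{..A}" "\<lambda>a'. \<Sum>i'=1..L. \<gamma> a a' * \<eta> i' * (u (t + a', a', i') - u (r + a', a', i'))"])
        (auto intro!: sum_nonneg)
    finally show "\<not> next_val u a r < next_val u a t \<Longrightarrow> False" by simp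
  qed
  show thesis
  proof (rule that[of "\<lambda>q a i. highest (p i) (next_val u a) q"])
    show "monotone_rates (\<lambda>q a i. highest (p i) (next_val u a) q)"
      using highest_monotone_rates[OF shape(2)] .
    fix q a i s assume x: "(q, a, i) \<in> X" and pos: "0 < \<pi> (q, a, i)" "0 < f q a i s"
    let ?t = "highest (p i) (next_val u a) q"
    have s: "s \<in> best (p i) (next_val u a) q" using optimal_best[OF opt u shape(2) x pos] .
    have t: "?t \<in> best (p i) (next_val u a) q" using x by (intro highest_in) (simp add: mem_X)
    show "s = ?t"
    proof (rule ccontr)
      assume "s \<noteq> ?t"
      then have "s < ?t" using le_highest[OF s] by simp
      then have "next_val u a (q - ?t) < next_val u a (q - s)"
        using s t x A_le_Q by (intro next_less) (auto simp: best_def mem_rates mem_X)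
      then show False using s t by (simp add: best_def p)
    qed
  qed
qed

text \<open>Balance and power involve f only multiplied by \<pi>, so f may be redefined on states of
  mass 0. This lets a policy that is deterministic on its support be replaced by a fully
  deterministic one.\<close>

lemma agree_on_support:
  assumes \<pi>: "stationary f \<pi>"
    and eq: "\<And>q a i s. (q, a, i) \<in> X \<Longrightarrow> \<pi> (q, a, i) \<noteq> 0 \<Longrightarrow> f' q a i s = f q a i s"
  shows agree_stationary: "stationary f' \<pi>" and agree_mean_power: "mean_power f' \<pi> = mean_power f \<pi>"
proof -
  have "\<pi> x * system_step S \<gamma> \<eta> f' x y = \<pi> x * system_step S \<gamma> \<eta> f x y" if "x \<in> X" for x y
    using eq that by (cases "\<pi> x = 0") (auto simp: system_step_def split: prod.split intro!: sum.cong)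
  then have "(\<Sum>x\<in>X. \<pi> x * system_step S \<gamma> \<eta> f' x y) = (\<Sum>x\<in>X. \<pi> x * system_step S \<gamma> \<eta> f x y)" for y
    by (intro sum.cong refl)
  then show "stationary f' \<pi>"
    using \<pi> by (simp add: stationary_def stationary_distribution_def)
  have "\<pi> (q, a, i) * f' q a i s = \<pi> (q, a, i) * f q a i s" if "(q, a, i) \<in> X" for q a i s
    using eq[OF that] by (cases "\<pi> (q, a, i) = 0") auto
  then show "mean_power f' \<pi> = mean_power f \<pi>"
    unfolding mean_power_def mult.assoc by (intro sum.cong refl) (auto simp only: split: prod.split intro!: sum.cong)
qed

end

section \<open>Positivity of the arrival rate, supporting weights and the final argument\<close>

lemma mean_arrivals_pos:
  assumes "0 < A" and \<gamma>: "ergodic_chain {..A} \<gamma>" and \<phi>: "stationary_distribution {..A} \<gamma> \<phi>"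
  shows "0 < mean_arrivals A \<phi>"
proof (rule ccontr)
  assume "\<not> 0 < mean_arrivals A \<phi>"
  moreover have nonneg: "0 \<le> \<phi> a" if "a \<le> A" for a
    using \<phi> that by (simp add: stationary_distribution_def)
  moreover have "0 \<le> mean_arrivals A \<phi>"
    using nonneg by (auto simp: mean_arrivals_def intro!: sum_nonneg)
  ultimately have "(\<Sum>a\<le>A. real a * \<phi> a) = 0" by (simp add: mean_arrivals_def)
  then have zero: "\<phi> a = 0" if "a \<le> A" "0 < a" for a
    using nonneg that by (subst (asm) sum_nonneg_eq_0_iff) (auto dest: bspec[of _ _ a])
  then have "(\<Sum>a\<le>A. \<phi> a) = (\<Sum>a\<le>A. if a = 0 then \<phi> 0 else 0)"
    by (intro sum.cong) auto
  then have \<phi>0: "\<phi> 0 = 1" using \<phi> by (simp add: stationary_distribution_def)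
  \<comment> \<open>With all mass at 0, the balance equation at b > 0 makes 0 absorbing, so 1 could
    never be reached from it.\<close>
  have stay: "\<gamma> 0 b = 0" if b: "b \<le> A" "0 < b" for b
  proof -
    have "(\<Sum>a\<le>A. \<phi> a * \<gamma> a b) = (\<Sum>a\<le>A. if a = 0 then \<gamma> 0 b else 0)"
      using zero \<phi>0 by (intro sum.cong) auto
    then show ?thesis using \<phi> b zero[OF b] by (simp add: stationary_distribution_def)
  qed
  have "n_step {..A} \<gamma> n 0 1 = 0" for n
  proof (induction n)
    case (Suc n)
    have "\<gamma> 0 z * n_step {..A} \<gamma> n z 1 = 0" if "z \<le> A" for z
      using stay[of z] that Suc by (cases "z = 0") auto
    then show ?case by (auto intro!: sum.neutral)
  qed simp
  moreover have "\<exists>n. 0 < n_step {..A} \<gamma> n 0 1"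
    using \<gamma> \<open>0 < A\<close> by (simp add: ergodic_chain_def)
  ultimately show False by simp
qed

text \<open>Weak optimality says that R misses the open quadrant strictly below the point in both
  coordinates, and a hyperplane separates the two convex sets. The quadrant extends to minus
  infinity in both directions, which forces nonnegative weights; its corner is the point itself,
  which yields the inequality.\<close>

lemma weak_pareto_weights:
  fixes R :: "(real \<times> real) set"
  assumes R: "convex R" "R \<noteq> {}" and pareto: "\<And>x y. (x, y) \<in> R \<Longrightarrow> x\<^sub>0 \<le> x \<or> y\<^sub>0 \<le> y"
  obtains l\<^sub>1 l\<^sub>2 where "0 \<le> l\<^sub>1" "0 \<le> l\<^sub>2" "0 < l\<^sub>1 \<or> 0 < l\<^sub>2"
    "\<And>x y. (x, y) \<in> R \<Longrightarrow> l\<^sub>1 * x\<^sub>0 + l\<^sub>2 * y\<^sub>0 \<le> l\<^sub>1 * x + l\<^sub>2 * y"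
proof -
  define Z where "Z = {..<x\<^sub>0} \<times> {..<y\<^sub>0}"
  have "convex Z" unfolding Z_def by (intro convex_Times convex_real_interval)
  moreover have "(x\<^sub>0 - 1, y\<^sub>0 - 1) \<in> Z" by (simp add: Z_def)
  moreover have "Z \<inter> R = {}" using pareto by (force simp: Z_def)
  ultimately obtain l b where l: "l \<noteq> 0" "\<forall>z\<in>Z. inner l z \<le> b" "\<forall>z\<in>R. b \<le> inner l z"
    using separating_hyperplane_sets[of Z R] R by blast
  obtain l\<^sub>1 l\<^sub>2 where l12: "l = (l\<^sub>1, l\<^sub>2)" by (cases l)
  have Zb: "l\<^sub>1 * (x\<^sub>0 - s) + l\<^sub>2 * (y\<^sub>0 - t) \<le> b" if "0 < s" "0 < t" for s t
    using l(2)[rule_format, of "(x\<^sub>0 - s, y\<^sub>0 - t)"] that by (simp add: Z_def l12)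
  define c where "c = l\<^sub>1 * x\<^sub>0 + l\<^sub>2 * y\<^sub>0"
  have Zc: "c - b \<le> l\<^sub>1 * s + l\<^sub>2 * t" if "0 < s" "0 < t" for s t
    using Zb[OF that] by (simp add: c_def algebra_simps)
  \<comment> \<open>A negative slope k violates the bound B far enough out; the witness in the proof
    makes \<open>k * s\<close> equal to -|B| - 1.\<close>
  have unbounded: False if neg: "k < 0" and le: "\<And>s. 0 < s \<Longrightarrow> B \<le> k * s" for k B :: real
  proof -
    have "k * ((\<bar>B\<bar> + 1) / - k) = - \<bar>B\<bar> - 1" using neg by (simp add: field_simps)
    moreover have "0 < (\<bar>B\<bar> + 1) / - k" using neg by (intro divide_pos_pos) auto
    ultimately have "B \<le> - \<bar>B\<bar> - 1" using le[of "(\<bar>B\<bar> + 1) / - k"] by metis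
    then show False by linarith
  qed
  have "0 \<le> l\<^sub>1"
  proof (rule ccontr)
    assume "\<not> 0 \<le> l\<^sub>1"
    then show False using Zc[of _ 1] by (intro unbounded[of l\<^sub>1 "c - b - l\<^sub>2"]) (auto simp: algebra_simps)
  qed
  moreover have "0 \<le> l\<^sub>2"
  proof (rule ccontr)
    assume "\<not> 0 \<le> l\<^sub>2"
    then show False using Zc[of 1] by (intro unbounded[of l\<^sub>2 "c - b - l\<^sub>1"]) (auto simp: algebra_simps)
  qed
  moreover have "0 < l\<^sub>1 \<or> 0 < l\<^sub>2"
    using l(1) calculation by (auto simp: l12 zero_prod_def)
  moreover have "c \<le> b"
  proof (rule field_le_epsilon)
    fix e :: real assume e: "0 < e"
    have sum_pos: "0 < l\<^sub>1 + l\<^sub>2" using calculation by auto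
    \<comment> \<open>Approach the corner along the diagonal, with the step chosen so that the
      weighted loss is exactly e.\<close>
    then have "c - b \<le> (l\<^sub>1 + l\<^sub>2) * (e / (l\<^sub>1 + l\<^sub>2))"
      using Zc[of "e / (l\<^sub>1 + l\<^sub>2)" "e / (l\<^sub>1 + l\<^sub>2)"] e by (simp only: distrib_right divide_pos_pos)
    then show "c \<le> b + e" using sum_pos by simp
  qed
  ultimately show thesis
    using that[of l\<^sub>1 l\<^sub>2] l(3) by (force simp: c_def l12)
qed

theorem theorem8:
  fixes A S Q L :: nat
    and \<gamma> :: "nat \<Rightarrow> nat \<Rightarrow> real" and \<phi> \<eta> :: "nat \<Rightarrow> real"
    and h :: "nat \<Rightarrow> complex" and P :: "complex \<Rightarrow> nat \<Rightarrow> real"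
    and Pstar Dstar :: real
  assumes "0 < A" and "0 < S" and "0 < Q" and "0 < L" and "A \<le> S" and "A \<le> Q"
    and "ergodic_chain {..A} \<gamma>"
    and "stationary_distribution {..A} \<gamma> \<phi>"
    and "\<forall>i\<in>{1..L}. 0 \<le> \<eta> i" and "(\<Sum>i=1..L. \<eta> i) = 1"
    and "\<forall>i\<in>{1..L}. 0 < cmod (h i)"
    and "strict_mono_on {1..L} (\<lambda>i. cmod (h i))"
    and "\<forall>i\<in>{1..L}. P (h i) 0 = 0 \<and> mono_on {..S} (P (h i)) \<and> convex_seq S (P (h i))"
    and "(Pstar, Dstar) \<in> tradeoff_curve A S Q L \<gamma> \<phi> \<eta> h P"
  shows "\<exists>f. is_policy A S Q L f \<and>
             obtains_pair A S Q L \<gamma> \<phi> \<eta> h P f (Pstar, Dstar) \<and>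
             (\<exists>thr. valid_thresholds A S Q L thr \<and>
                (\<exists>s\<^sub>0\<le>S. \<exists>a\<^sub>0\<le>A. \<exists>i\<^sub>0\<in>{1..L}.
                   threshold_form A S Q L thr s\<^sub>0 a\<^sub>0 i\<^sub>0 f))"
proof -
  note P = assms(13)
  \<comment> \<open>This instance supplies the true power and the notions that involve neither
    prices nor w; the queue weight 0 is a placeholder.\<close>
  interpret power: queue_mdp A S Q L \<gamma> \<eta> "\<lambda>i. P (h i)" 0
    by unfold_locales (use assms in auto)
  define \<alpha> where "\<alpha> = mean_arrivals A \<phi>"
  have \<alpha>: "0 < \<alpha>" unfolding \<alpha>_def using assms(1,7,8) by (rule mean_arrivals_pos)
  define R where "R = achievable_pairs A S Q L \<gamma> \<phi> \<eta> h P"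
  have obtains_iff: "obtains_pair A S Q L \<gamma> \<phi> \<eta> h P f z \<longleftrightarrow>
      (\<exists>\<pi>. power.stationary f \<pi> \<and> z = (power.mean_power f \<pi>, power.mean_queue \<pi> / \<alpha>))" for f z
    by (cases z) (simp add: obtains_pair_def power.stationary_def power.mean_power_def
        power.mean_queue_def \<alpha>_def)
  have R_iff: "z \<in> R \<longleftrightarrow> (\<exists>f \<pi>. power.policy f \<and> power.stationary f \<pi> \<and>
      z = (power.mean_power f \<pi>, power.mean_queue \<pi> / \<alpha>))" for z
    by (auto simp: R_def achievable_pairs_def obtains_iff)
  have "convex R"
  proof (rule convexI)
    fix y z and s t :: real assume y: "y \<in> R" and z: "z \<in> R" and st: "0 \<le> s" "0 \<le> t" "s + t = 1"
    obtain f\<^sub>1 \<pi>\<^sub>1 where 1: "power.policy f\<^sub>1" "power.stationary f\<^sub>1 \<pi>\<^sub>1"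
        "y = (power.mean_power f\<^sub>1 \<pi>\<^sub>1, power.mean_queue \<pi>\<^sub>1 / \<alpha>)"
      using y R_iff by auto
    obtain f\<^sub>2 \<pi>\<^sub>2 where 2: "power.policy f\<^sub>2" "power.stationary f\<^sub>2 \<pi>\<^sub>2"
        "z = (power.mean_power f\<^sub>2 \<pi>\<^sub>2, power.mean_queue \<pi>\<^sub>2 / \<alpha>)"
      using z R_iff by auto
    have s: "s \<le> 1" "t = 1 - s" using st by auto
    obtain f \<pi> where "power.policy f" "power.stationary f \<pi>"
      "power.mean_queue \<pi> = s * power.mean_queue \<pi>\<^sub>1 + (1 - s) * power.mean_queue \<pi>\<^sub>2"
      "power.mean_power f \<pi> = s * power.mean_power f\<^sub>1 \<pi>\<^sub>1 + (1 - s) * power.mean_power f\<^sub>2 \<pi>\<^sub>2"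
      using power.mixture[OF 1(1) 2(1) 1(2) 2(2) st(1) s(1)] by metis
    then show "s *\<^sub>R y + t *\<^sub>R z \<in> R"
      unfolding R_iff s(2) 1(3) 2(3) by (intro exI[of _ f] exI[of _ \<pi>]) (simp add: add_divide_distrib)
  qed
  moreover have star: "(Pstar, Dstar) \<in> R" "\<And>x y. (x, y) \<in> R \<Longrightarrow> Pstar \<le> x \<or> Dstar \<le> y"
    using assms(14) by (auto simp: R_def tradeoff_curve_def)
  ultimately obtain l\<^sub>1 l\<^sub>2 where l: "0 \<le> l\<^sub>1" "0 \<le> l\<^sub>2" "0 < l\<^sub>1 \<or> 0 < l\<^sub>2"
    and min: "\<And>x y. (x, y) \<in> R \<Longrightarrow> l\<^sub>1 * Pstar + l\<^sub>2 * Dstar \<le> l\<^sub>1 * x + l\<^sub>2 * y"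
    using weak_pareto_weights[of R Pstar Dstar] by blast
  obtain f \<pi> where f: "power.policy f" "power.stationary f \<pi>"
    and Pstar: "Pstar = power.mean_power f \<pi>" and Dstar: "Dstar = power.mean_queue \<pi> / \<alpha>"
    using star(1) R_iff by auto
  \<comment> \<open>The queue weight is divided by \<alpha> because D is the mean queue length over
    \<alpha>. Policies, stationarity, mean queue length and \<open>single_cell\<close> mention
    neither prices nor w, so they coincide in both instances.\<close>
  interpret weighted: queue_mdp A S Q L \<gamma> \<eta> "\<lambda>i s. l\<^sub>1 * P (h i) s" "l\<^sub>2 / \<alpha>"
  proof unfold_locales
    fix i assume i: "i \<in> {1..L}"
    show "mono_on {..S} (\<lambda>s. l\<^sub>1 * P (h i) s)"
      using P i l(1) by (auto simp: monotone_on_def mult_left_mono)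
    show "convex_seq S (\<lambda>s. l\<^sub>1 * P (h i) s)"
      using P i l(1) by (auto simp: convex_seq_def right_diff_distrib[symmetric] intro!: mult_left_mono)
  qed (use assms l \<alpha> in auto)
  have weighted_power: "weighted.mean_power f' \<pi>' = l\<^sub>1 * power.mean_power f' \<pi>'" for f' \<pi>'
    unfolding weighted.mean_power_def power.mean_power_def sum_distrib_left
    by (intro sum.cong) (auto simp: sum_distrib_left mult_ac)
  have cost: "weighted.mean_cost f' \<pi>' = l\<^sub>1 * power.mean_power f' \<pi>' + l\<^sub>2 * (power.mean_queue \<pi>' / \<alpha>)"
    for f' \<pi>'
    by (simp add: weighted.mean_cost_def weighted_power)
  have opt: "weighted.optimal f \<pi>"
    unfolding weighted.optimal_def cost
    using f min[unfolded Pstar Dstar] R_iff by blast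
  have "\<exists>f' \<pi>' \<sigma> q\<^sub>0 a\<^sub>0 i\<^sub>0. power.policy f' \<and> power.stationary f' \<pi>' \<and>
      power.mean_queue \<pi>' = power.mean_queue \<pi> \<and> power.mean_power f' \<pi>' = power.mean_power f \<pi> \<and>
      power.single_cell f' \<sigma> q\<^sub>0 a\<^sub>0 i\<^sub>0"
  proof (cases "l\<^sub>1 = 0")
    case False
    \<comment> \<open>The lemma equates \<open>l\<^sub>1\<close> times the powers, and the nonzero
      factor cancels.\<close>
    then show ?thesis
      using weighted.optimal_single_cell[OF opt] by (simp add: weighted_power)
  next
    case True
    then have "0 < l\<^sub>2 / \<alpha>" using l \<alpha> by simp
    then obtain \<sigma> where \<sigma>: "power.monotone_rates \<sigma>"
      and supp: "\<And>q a i s. (q, a, i) \<in> states A Q L \<Longrightarrow> 0 < \<pi> (q, a, i) \<Longrightarrow> 0 < f q a i s \<Longrightarrow> s = \<sigma> q a i"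
      using weighted.optimal_queue_deterministic[OF opt] True by auto
    \<comment> \<open>The rates of f are determined only on the support of \<pi>; off it f is
      replaced by \<sigma>, which leaves \<pi>, and hence both means, unchanged.\<close>
    have agree: "deterministic \<sigma> q a i s = f q a i s"
      if x: "(q, a, i) \<in> states A Q L" and "\<pi> (q, a, i) \<noteq> 0" for q a i s
    proof -
      have "0 < \<pi> (q, a, i)" using power.stationary_nonneg[OF f(2) x] that(2) by simp
      have zero: "f q a i t = 0" if "t \<noteq> \<sigma> q a i" for t
      proof (rule ccontr)
        assume "f q a i t \<noteq> 0"
        then have "0 < f q a i t"
          using power.policy_nonneg[OF f(1) x, of t] power.policy_rates[OF f(1) x, of t]
          by (simp add: power.mem_rates less_le)
        then show False using supp[OF x \<open>0 < \<pi> (q, a, i)\<close>] that by blast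
      qed
      have "\<sigma> q a i \<le> S" using power.monotone_ratesD(1)[OF \<sigma> x] by (simp add: power.mem_rates)
      then have "(\<Sum>t\<le>S. f q a i t) = f q a i (\<sigma> q a i)"
        using zero by (subst sum.remove[of _ "\<sigma> q a i"]) (auto intro!: sum.neutral)
      then show ?thesis
        using power.policy_sum[OF f(1) x] zero by (auto simp: deterministic_def)
    qed
    show ?thesis
      using power.agree_stationary[OF f(2) agree] power.agree_mean_power[OF f(2) agree]
        power.monotone_rates_policy[OF \<sigma>] power.single_cell_deterministic[OF \<sigma>] by blast
  qed
  then obtain f' \<pi>' \<sigma> q\<^sub>0 a\<^sub>0 i\<^sub>0 where f': "power.policy f'" "power.stationary f' \<pi>'"
      "power.mean_queue \<pi>' = power.mean_queue \<pi>" "power.mean_power f' \<pi>' = power.mean_power f \<pi>"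
    and cell: "power.single_cell f' \<sigma> q\<^sub>0 a\<^sub>0 i\<^sub>0"
    by blast
  have "obtains_pair A S Q L \<gamma> \<phi> \<eta> h P f' (Pstar, Dstar)"
    unfolding obtains_iff Pstar Dstar using f' by (intro exI[of _ \<pi>']) simp
  then show ?thesis using f'(1) power.single_cell_threshold_form[OF cell] by blast
qed

end
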